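(* Let $(A,[\cdot,\cdot],\rho)$ be a complex Lie algebroid over $M$, and let $A_{\min}=A^{\mathrm{re}}+j_A(A^{\mathrm{re}})$. If $A_{\min}$ is a regular distribution (i.e. a complex vector subbundle of $A$), then the triple $(A_{\min},[\cdot,\cdot]_{\min},\rho_{\min})$, where $[\cdot,\cdot]_{\min}$ and $\rho_{\min}$ are the restrictions of $[\cdot,\cdot]$ and $\rho$ to $A_{\min}$, is a complex Lie subalgebroid of $A$, and it satisfies $(A_{\min})^{\mathrm{re}}=A^{\mathrm{re}}$.
   Context: A complex Lie algebroid over a smooth real manifold $M$ is a complex vector bundle $A\to M$ with a $\mathbb{C}$-bilinear Lie bracket on $\Gamma(A)$ (satisfying Jacobi) and a $\mathbb{C}$-linear bundle map $\rho:A\to T_{\mathbb{C}}M=TM\otimes\mathbb{C}$ preserving brackets and satisfying $[\alpha,f\beta]=f[\alpha,\beta]+(\rho(\alpha)f)\beta$ for $f\in C^\infty(M,\mathbb{C})$. Write $\rho=\rho_1+i\rho_2$ with $\rho_1,\rho_2:A\to TM$ real-linear; $A^{\mathrm{re}}=\ker\rho_2$ (fiberwise kernel, possibly of varying rank), i.e. the set of $e\in A$ with $\rho(e)\in TM$. $j_A:A\to A$ is multiplication by $i$. The fiberwise sum $A_{\min}$ is $j_A$-invariant and so is a distribution of complex subspaces of $A$. *)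

theory Defs
  imports "HOL-Analysis.Analysis"
begin

section \<open>Smooth functions on open subsets of Euclidean space\<close>

text \<open>
  Points of \<open>n\<close>-dimensional Euclidean space are functions \<open>nat \<Rightarrow> real\<close> vanishing from index \<open>n\<close>
  onwards, as in \<^const>\<open>Euclidean_space\<close>; the dimension \<open>n\<close> is a term and may be \<open>0\<close>.
\<close>

definition partial_deriv ::
  "nat \<Rightarrow> ((nat \<Rightarrow> real) \<Rightarrow> 'v::real_normed_vector) \<Rightarrow> (nat \<Rightarrow> real) \<Rightarrow> 'v" where
  "partial_deriv i f x = vector_derivative (\<lambda>t. f (x(i := t))) (at (x i))"

text \<open>\<open>Ck_on n k V f\<close>: on \<open>V\<close>, open in the \<open>n\<close>-dimensional space, all partial derivatives of \<open>f\<close> of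
  order at most \<open>k\<close> exist and are continuous.\<close>

primrec Ck_on ::
  "nat \<Rightarrow> nat \<Rightarrow> (nat \<Rightarrow> real) set \<Rightarrow> ((nat \<Rightarrow> real) \<Rightarrow> 'v::real_normed_vector) \<Rightarrow> bool" where
  "Ck_on n 0 V f = continuous_on V f"
| "Ck_on n (Suc k) V f =
     (continuous_on V f \<and>
      (\<forall>i<n. (\<forall>x\<in>V. (\<lambda>t. f (x(i := t))) differentiable (at (x i))) \<and>
             Ck_on n k V (partial_deriv i f)))"

definition Cinf_on ::
  "nat \<Rightarrow> (nat \<Rightarrow> real) set \<Rightarrow> ((nat \<Rightarrow> real) \<Rightarrow> 'v::real_normed_vector) \<Rightarrow> bool" where
  "Cinf_on n V f \<longleftrightarrow> (\<forall>k. Ck_on n k V f)"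


section \<open>Smooth manifolds\<close>

text \<open>The underlying set of the manifold is the whole type \<open>'m\<close>.\<close>

record 'm manifold =
  mfd_dim :: nat
  charts :: "('m set \<times> ('m \<Rightarrow> nat \<Rightarrow> real)) set"

definition is_chart ::
  "nat \<Rightarrow> 'm::topological_space set \<Rightarrow> ('m \<Rightarrow> nat \<Rightarrow> real) \<Rightarrow> bool" where
  "is_chart n U \<psi> \<longleftrightarrow>
     open U \<and> openin (Euclidean_space n) (\<psi> ` U) \<and>
     homeomorphic_map (top_of_set U) (subtopology (Euclidean_space n) (\<psi> ` U)) \<psi>"

locale smooth_manifold =
  fixes M :: "'m::{t2_space, second_countable_topology} manifold"
  assumes chart: "(U, \<psi>) \<in> charts M \<Longrightarrow> is_chart (mfd_dim M) U \<psi>"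
    and charts_cover: "(\<Union>(U, \<psi>)\<in>charts M. U) = UNIV"
    and charts_compatible: "\<lbrakk>(U, \<psi>) \<in> charts M; (V, \<phi>) \<in> charts M; i < mfd_dim M\<rbrakk> \<Longrightarrow>
      Cinf_on (mfd_dim M) (\<psi> ` (U \<inter> V)) (\<lambda>y. \<phi> (inv_into U \<psi> y) i)"

definition smooth_on ::
  "'m manifold \<Rightarrow> 'm set \<Rightarrow> ('m \<Rightarrow> 'v::real_normed_vector) \<Rightarrow> bool" where
  "smooth_on M W f \<longleftrightarrow>
     (\<forall>(U, \<psi>)\<in>charts M. Cinf_on (mfd_dim M) (\<psi> ` (U \<inter> W)) (\<lambda>y. f (inv_into U \<psi> y)))"

definition smooth_functions :: "'m manifold \<Rightarrow> ('m \<Rightarrow> 'v::real_normed_vector) set" where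
  "smooth_functions M = {f. smooth_on M UNIV f}"


section \<open>The tangent bundle and its complexification\<close>

text \<open>
  Tangent vectors are derivations of the algebra of smooth real functions. They are represented
  by functionals on all functions, so the value on functions that are not smooth is fixed to
  be \<open>0\<close>.
\<close>

type_synonym 'm tangent = "('m \<Rightarrow> real) \<Rightarrow> real"

definition tangent_space :: "'m manifold \<Rightarrow> 'm \<Rightarrow> 'm tangent set" where
  "tangent_space M x = {v.
     (\<forall>f. f \<notin> smooth_functions M \<longrightarrow> v f = 0) \<and>
     (\<forall>f\<in>smooth_functions M. \<forall>g\<in>smooth_functions M. v (\<lambda>y. f y + g y) = v f + v g) \<and>
     (\<forall>c. \<forall>f\<in>smooth_functions M. v (\<lambda>y. c * f y) = c * v f) \<and>
     (\<forall>f\<in>smooth_functions M. \<forall>g\<in>smooth_functions M.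
        v (\<lambda>y. f y * g y) = f x * v g + v f * g x)}"

text \<open>The pair \<open>(v, w)\<close> stands for the element \<open>v + i w\<close> of the complexified tangent space; it is
  real, i.e. a tangent vector, iff its second component is zero.\<close>

type_synonym 'm ctangent = "'m tangent \<times> 'm tangent"

definition ctangent_space :: "'m manifold \<Rightarrow> 'm \<Rightarrow> 'm ctangent set" where
  "ctangent_space M x = tangent_space M x \<times> tangent_space M x"

definition ctangent_add :: "'m ctangent \<Rightarrow> 'm ctangent \<Rightarrow> 'm ctangent" where
  "ctangent_add X Y = (\<lambda>f. fst X f + fst Y f, \<lambda>f. snd X f + snd Y f)"

definition ctangent_scale :: "complex \<Rightarrow> 'm ctangent \<Rightarrow> 'm ctangent" where
  "ctangent_scale c X =
     (\<lambda>f. Re c * fst X f - Im c * snd X f, \<lambda>f. Re c * snd X f + Im c * fst X f)"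

text \<open>Complex-linear extension to complex-valued functions:
  \<open>(v + i w)(g + i h) = (v g - w h) + i (v h + w g)\<close>.\<close>

definition ctangent_apply :: "'m ctangent \<Rightarrow> ('m \<Rightarrow> complex) \<Rightarrow> complex" where
  "ctangent_apply X f =
     Complex (fst X (\<lambda>y. Re (f y)) - snd X (\<lambda>y. Im (f y)))
             (fst X (\<lambda>y. Im (f y)) + snd X (\<lambda>y. Re (f y)))"

definition vf_apply :: "('m \<Rightarrow> 'm ctangent) \<Rightarrow> ('m \<Rightarrow> complex) \<Rightarrow> 'm \<Rightarrow> complex" where
  "vf_apply X f = (\<lambda>x. ctangent_apply (X x) f)"

definition smooth_cvector_fields :: "'m manifold \<Rightarrow> ('m \<Rightarrow> 'm ctangent) set" where
  "smooth_cvector_fields M = {X.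
     (\<forall>x. X x \<in> ctangent_space M x) \<and>
     (\<forall>f\<in>smooth_functions M. vf_apply X f \<in> smooth_functions M)}"

text \<open>The commutator \<open>X Y - Y X\<close>, whose real and imaginary parts are recovered from its values
  on real functions.\<close>

definition vf_bracket ::
  "'m manifold \<Rightarrow> ('m \<Rightarrow> 'm ctangent) \<Rightarrow> ('m \<Rightarrow> 'm ctangent) \<Rightarrow> 'm \<Rightarrow> 'm ctangent" where
  "vf_bracket M X Y x =
     (let D = (\<lambda>f. if f \<in> smooth_functions M
                   then vf_apply X (vf_apply Y (\<lambda>y. complex_of_real (f y))) x
                      - vf_apply Y (vf_apply X (\<lambda>y. complex_of_real (f y))) x
                   else 0)
      in (\<lambda>f. Re (D f), \<lambda>f. Im (D f)))"


section \<open>Complex vector bundles\<close>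

text \<open>
  A complex vector bundle is given by its total space, projection and fibrewise operations
  together with a bundle atlas of local trivializations \<open>(U, r, \<phi>)\<close>, where \<open>\<phi>\<close> maps the part of
  the total space over \<open>U\<close> to \<open>r\<close>-dimensional complex space (the base point is not recorded in
  \<open>\<phi>\<close>). The bundle atlas determines the smooth structure of the total space. The rank is locally
  constant.
\<close>

record ('m, 'e) cvbundle =
  total_space :: "'e set"
  bproj :: "'e \<Rightarrow> 'm"
  fib_zero :: "'m \<Rightarrow> 'e"
  fib_add :: "'e \<Rightarrow> 'e \<Rightarrow> 'e"
  fib_scale :: "complex \<Rightarrow> 'e \<Rightarrow> 'e"
  trivs :: "('m set \<times> nat \<times> ('e \<Rightarrow> nat \<Rightarrow> complex)) set"

definition fibre :: "('m, 'e) cvbundle \<Rightarrow> 'm \<Rightarrow> 'e set" where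
  "fibre A x = {e \<in> total_space A. bproj A e = x}"

definition cspace :: "nat \<Rightarrow> (nat \<Rightarrow> complex) set" where
  "cspace r = {z. \<forall>i\<ge>r. z i = 0}"

definition cunit :: "nat \<Rightarrow> nat \<Rightarrow> complex" where
  "cunit j = (\<lambda>i. if i = j then 1 else 0)"

text \<open>\<open>\<phi>\<close> restricts to a linear isomorphism from each fibre over \<open>U\<close> to \<open>cspace r\<close>; in particular
  these fibres are complex vector spaces of dimension \<open>r\<close>.\<close>

definition fibrewise_iso ::
  "('m, 'e) cvbundle \<Rightarrow> 'm set \<Rightarrow> nat \<Rightarrow> ('e \<Rightarrow> nat \<Rightarrow> complex) \<Rightarrow> bool" where
  "fibrewise_iso A U r \<phi> \<longleftrightarrow> (\<forall>x\<in>U.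
     bij_betw \<phi> (fibre A x) (cspace r) \<and>
     \<phi> (fib_zero A x) = (\<lambda>i. 0) \<and>
     (\<forall>a\<in>fibre A x. \<forall>b\<in>fibre A x. \<phi> (fib_add A a b) = (\<lambda>i. \<phi> a i + \<phi> b i)) \<and>
     (\<forall>c. \<forall>a\<in>fibre A x. \<phi> (fib_scale A c a) = (\<lambda>i. c * \<phi> a i)))"

text \<open>Smoothness of the matrix entries of \<open>\<psi> \<circ> \<phi>\<^sup>-\<^sup>1\<close> as functions of the base point.\<close>

definition smooth_transition ::
  "'m manifold \<Rightarrow> ('m, 'e) cvbundle \<Rightarrow> 'm set \<times> nat \<times> ('e \<Rightarrow> nat \<Rightarrow> complex)
    \<Rightarrow> 'm set \<times> nat \<times> ('e \<Rightarrow> nat \<Rightarrow> complex) \<Rightarrow> bool" where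
  "smooth_transition M A = (\<lambda>(U, r, \<phi>) (V, s, \<psi>).
     \<forall>j<r. \<forall>i<s. smooth_on M (U \<inter> V) (\<lambda>x. \<psi> (inv_into (fibre A x) \<phi> (cunit j)) i))"

locale complex_vector_bundle = smooth_manifold M
  for M :: "'m::{t2_space, second_countable_topology} manifold" +
  fixes A :: "('m, 'e) cvbundle"
  assumes fib_zero_closed: "fib_zero A x \<in> fibre A x"
    and fib_add_closed: "\<lbrakk>a \<in> fibre A x; b \<in> fibre A x\<rbrakk> \<Longrightarrow> fib_add A a b \<in> fibre A x"
    and fib_scale_closed: "a \<in> fibre A x \<Longrightarrow> fib_scale A c a \<in> fibre A x"
    and triv: "(U, r, \<phi>) \<in> trivs A \<Longrightarrow> open U \<and> fibrewise_iso A U r \<phi>"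
    and trivs_cover: "(\<Union>(U, r, \<phi>)\<in>trivs A. U) = UNIV"
    and trivs_compatible: "\<lbrakk>T \<in> trivs A; T' \<in> trivs A\<rbrakk> \<Longrightarrow> smooth_transition M A T T'"

definition local_trivializations ::
  "'m::topological_space manifold \<Rightarrow> ('m, 'e) cvbundle
    \<Rightarrow> ('m set \<times> nat \<times> ('e \<Rightarrow> nat \<Rightarrow> complex)) set" where
  "local_trivializations M A = {(U, r, \<phi>). open U \<and> fibrewise_iso A U r \<phi> \<and>
     (\<forall>T\<in>trivs A. smooth_transition M A (U, r, \<phi>) T \<and> smooth_transition M A T (U, r, \<phi>))}"

definition sections :: "'m manifold \<Rightarrow> ('m, 'e) cvbundle \<Rightarrow> ('m \<Rightarrow> 'e) set" where
  "sections M A = {\<alpha>. (\<forall>x. \<alpha> x \<in> fibre A x) \<and>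
     (\<forall>(U, r, \<phi>)\<in>trivs A. \<forall>i<r. smooth_on M U (\<lambda>x. \<phi> (\<alpha> x) i))}"

definition sec_add :: "('m, 'e) cvbundle \<Rightarrow> ('m \<Rightarrow> 'e) \<Rightarrow> ('m \<Rightarrow> 'e) \<Rightarrow> 'm \<Rightarrow> 'e" where
  "sec_add A \<alpha> \<beta> = (\<lambda>x. fib_add A (\<alpha> x) (\<beta> x))"

definition sec_scale :: "('m, 'e) cvbundle \<Rightarrow> ('m \<Rightarrow> complex) \<Rightarrow> ('m \<Rightarrow> 'e) \<Rightarrow> 'm \<Rightarrow> 'e" where
  "sec_scale A f \<alpha> = (\<lambda>x. fib_scale A (f x) (\<alpha> x))"

text \<open>
  A set \<open>B\<close> of vectors of \<open>A\<close> is a subbundle iff near every point some smooth local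
  trivialization of \<open>A\<close> straightens it to \<open>cspace k \<subseteq> cspace r\<close>. Such a \<open>\<phi>\<close>, with \<open>r\<close> replaced by
  \<open>k\<close>, then serves as a local trivialization of \<open>B\<close>.
\<close>

definition adapted_trivs ::
  "'m::topological_space manifold \<Rightarrow> ('m, 'e) cvbundle \<Rightarrow> 'e set
    \<Rightarrow> ('m set \<times> nat \<times> ('e \<Rightarrow> nat \<Rightarrow> complex)) set" where
  "adapted_trivs M A B = {(U, k, \<phi>). \<exists>r\<ge>k. (U, r, \<phi>) \<in> local_trivializations M A \<and>
     (\<forall>x\<in>U. \<forall>e\<in>fibre A x. e \<in> B \<longleftrightarrow> \<phi> e \<in> cspace k)}"

definition is_subbundle ::
  "'m::topological_space manifold \<Rightarrow> ('m, 'e) cvbundle \<Rightarrow> 'e set \<Rightarrow> bool" where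
  "is_subbundle M A B \<longleftrightarrow>
     B \<subseteq> total_space A \<and> (\<Union>(U, k, \<phi>)\<in>adapted_trivs M A B. U) = UNIV"

definition subbundle ::
  "'m::topological_space manifold \<Rightarrow> ('m, 'e) cvbundle \<Rightarrow> 'e set \<Rightarrow> ('m, 'e) cvbundle" where
  "subbundle M A B = A\<lparr>total_space := B, trivs := adapted_trivs M A B\<rparr>"


section \<open>Complex Lie algebroids\<close>

locale complex_lie_algebroid = complex_vector_bundle M A
  for M :: "'m::{t2_space, second_countable_topology} manifold" and A :: "('m, 'e) cvbundle" +
  fixes br :: "('m \<Rightarrow> 'e) \<Rightarrow> ('m \<Rightarrow> 'e) \<Rightarrow> 'm \<Rightarrow> 'e"
    and \<rho> :: "'e \<Rightarrow> 'm ctangent"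
  assumes br_closed: "\<lbrakk>\<alpha> \<in> sections M A; \<beta> \<in> sections M A\<rbrakk> \<Longrightarrow> br \<alpha> \<beta> \<in> sections M A"
    and br_add_left: "\<lbrakk>\<alpha> \<in> sections M A; \<beta> \<in> sections M A; \<gamma> \<in> sections M A\<rbrakk> \<Longrightarrow>
      br (sec_add A \<alpha> \<beta>) \<gamma> = sec_add A (br \<alpha> \<gamma>) (br \<beta> \<gamma>)"
    and br_add_right: "\<lbrakk>\<alpha> \<in> sections M A; \<beta> \<in> sections M A; \<gamma> \<in> sections M A\<rbrakk> \<Longrightarrow>
      br \<alpha> (sec_add A \<beta> \<gamma>) = sec_add A (br \<alpha> \<beta>) (br \<alpha> \<gamma>)"
    and br_scale_left: "\<lbrakk>\<alpha> \<in> sections M A; \<beta> \<in> sections M A\<rbrakk> \<Longrightarrow>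
      br (sec_scale A (\<lambda>x. c) \<alpha>) \<beta> = sec_scale A (\<lambda>x. c) (br \<alpha> \<beta>)"
    and br_scale_right: "\<lbrakk>\<alpha> \<in> sections M A; \<beta> \<in> sections M A\<rbrakk> \<Longrightarrow>
      br \<alpha> (sec_scale A (\<lambda>x. c) \<beta>) = sec_scale A (\<lambda>x. c) (br \<alpha> \<beta>)"
    and br_alternating: "\<alpha> \<in> sections M A \<Longrightarrow> br \<alpha> \<alpha> = fib_zero A"
    and br_jacobi: "\<lbrakk>\<alpha> \<in> sections M A; \<beta> \<in> sections M A; \<gamma> \<in> sections M A\<rbrakk> \<Longrightarrow>
      sec_add A (br \<alpha> (br \<beta> \<gamma>)) (sec_add A (br \<beta> (br \<gamma> \<alpha>)) (br \<gamma> (br \<alpha> \<beta>))) = fib_zero A"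
    and anchor_fibre: "e \<in> fibre A x \<Longrightarrow> \<rho> e \<in> ctangent_space M x"
    and anchor_add: "\<lbrakk>a \<in> fibre A x; b \<in> fibre A x\<rbrakk> \<Longrightarrow>
      \<rho> (fib_add A a b) = ctangent_add (\<rho> a) (\<rho> b)"
    and anchor_scale: "a \<in> fibre A x \<Longrightarrow> \<rho> (fib_scale A c a) = ctangent_scale c (\<rho> a)"
    and anchor_smooth: "\<alpha> \<in> sections M A \<Longrightarrow> (\<lambda>x. \<rho> (\<alpha> x)) \<in> smooth_cvector_fields M"
    and anchor_br: "\<lbrakk>\<alpha> \<in> sections M A; \<beta> \<in> sections M A\<rbrakk> \<Longrightarrow>
      (\<lambda>x. \<rho> (br \<alpha> \<beta> x)) = vf_bracket M (\<lambda>x. \<rho> (\<alpha> x)) (\<lambda>x. \<rho> (\<beta> x))"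
    and br_leibniz: "\<lbrakk>\<alpha> \<in> sections M A; \<beta> \<in> sections M A; f \<in> smooth_functions M\<rbrakk> \<Longrightarrow>
      br \<alpha> (sec_scale A f \<beta>) =
        sec_add A (sec_scale A f (br \<alpha> \<beta>)) (sec_scale A (vf_apply (\<lambda>x. \<rho> (\<alpha> x)) f) \<beta>)"

text \<open>Closure of the sections of \<open>B\<close> under \<open>br\<close> is contained in the last conjunct, as
  \<open>br\<^sub>B\<close> takes values in the sections of the subbundle.\<close>

definition complex_lie_subalgebroid ::
  "'m::{t2_space, second_countable_topology} manifold \<Rightarrow> ('m, 'e) cvbundle
    \<Rightarrow> (('m \<Rightarrow> 'e) \<Rightarrow> ('m \<Rightarrow> 'e) \<Rightarrow> 'm \<Rightarrow> 'e) \<Rightarrow> ('e \<Rightarrow> 'm ctangent)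
    \<Rightarrow> 'e set \<Rightarrow> (('m \<Rightarrow> 'e) \<Rightarrow> ('m \<Rightarrow> 'e) \<Rightarrow> 'm \<Rightarrow> 'e) \<Rightarrow> ('e \<Rightarrow> 'm ctangent) \<Rightarrow> bool" where
  "complex_lie_subalgebroid M A br \<rho> B br\<^sub>B \<rho>\<^sub>B \<longleftrightarrow>
     complex_lie_algebroid M A br \<rho> \<and>
     is_subbundle M A B \<and>
     complex_lie_algebroid M (subbundle M A B) br\<^sub>B \<rho>\<^sub>B \<and>
     (\<forall>e\<in>B. \<rho>\<^sub>B e = \<rho> e) \<and>
     (\<forall>\<alpha>\<in>sections M (subbundle M A B). \<forall>\<beta>\<in>sections M (subbundle M A B). br\<^sub>B \<alpha> \<beta> = br \<alpha> \<beta>)"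

text \<open>\<open>snd (\<rho> e)\<close> is the imaginary part of \<open>\<rho> e\<close>.\<close>

definition re_part :: "('m, 'e) cvbundle \<Rightarrow> ('e \<Rightarrow> 'm ctangent) \<Rightarrow> 'e set" where
  "re_part A \<rho> = {e \<in> total_space A. snd (\<rho> e) = (\<lambda>f. 0)}"

definition min_part :: "('m, 'e) cvbundle \<Rightarrow> ('e \<Rightarrow> 'm ctangent) \<Rightarrow> 'e set" where
  "min_part A \<rho> = {fib_add A a (fib_scale A \<i> b) | a b.
     a \<in> re_part A \<rho> \<and> b \<in> re_part A \<rho> \<and> bproj A a = bproj A b}"

end

theory Submission
  imports Defs
begin

text \<open>
Write \<open>B\<close> for the subbundle \<^term>\<open>min_part A \<rho>\<close>. Splitting a vector into real and imaginary parts
  shows that \<open>e\<close> lies in \<open>B\<close> iff the complex conjugate of \<open>\<rho> e\<close> is again in the image of \<open>\<rho>\<close> on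
  the same fibre (\<open>min_part_iff\<close>); so \<open>\<rho>\<close> maps the fibres of \<open>B\<close> onto subspaces closed under
  conjugation. Everything except the closure of the sections of \<open>B\<close> under the bracket is then
  inherited from \<open>A\<close> (\<open>subbundle_restriction_subalgebroid\<close>).

  For the closure, let \<open>X = \<rho> \<alpha>\<close> and \<open>Y = \<rho> \<beta>\<close> with sections \<open>\<alpha>\<close>, \<open>\<beta>\<close> of \<open>B\<close>. If their conjugates
  were images of smooth sections \<open>\<alpha>'\<close>, \<open>\<beta>'\<close>, then the conjugate of \<open>\<rho> [\<alpha>, \<beta>] = [X, Y]\<close> would be
  \<open>\<rho> [\<alpha>', \<beta>']\<close> and the criterion would apply to \<open>[\<alpha>, \<beta>]\<close>. The conjugates do lie pointwise in \<open>\<rho> B\<close>,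
  but the rank of \<open>\<rho>\<close> on \<open>B\<close> may jump, so a smooth lift need not exist everywhere. It exists where the
  rank is locally constant, which is a dense open set, and since \<open>B\<close> is closed in \<open>A\<close> it suffices to
  see \<open>[\<alpha>, \<beta>]\<close> inside \<open>B\<close> on a dense set.

  Neither ranks nor local lifts are used literally. Suppose that \<open>[\<alpha>, \<beta>]\<close> leaves \<open>B\<close> somewhere; a bump
  function times a coordinate of \<open>[\<alpha>, \<beta>]\<close> is a global smooth \<open>u\<close>, not identically zero, such that
  \<open>[\<alpha>, \<beta>]\<close> is outside \<open>B\<close> wherever \<open>u\<close> is nonzero (\<open>section_outside_subbundle\<close>). Starting from \<open>u\<close>,
  division-free Gaussian elimination produces sections \<open>e\<^sub>i\<close> of \<open>B\<close>, functions \<open>f\<^sub>j\<close> and a function \<open>g\<close>,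
  not identically zero and vanishing where \<open>u\<close> does, with \<open>\<rho> e\<^sub>i f\<^sub>j = \<delta>\<^sub>i\<^sub>j g\<close> on all of \<open>M\<close>
  (\<open>dual_system_extend\<close>). The number of sections is bounded by a fibre dimension, and for a maximal
  system every vector field with values in \<open>\<rho> B\<close> becomes the image of a section of \<open>B\<close> after
  multiplication by \<open>G = g\<^sup>2\<close> (\<open>generic_lift\<close>). Applied to the conjugates of \<open>X\<close> and \<open>Y\<close> at a point with
  \<open>G \<noteq> 0\<close>, the Leibniz rule puts the conjugate of \<open>[X, Y]\<close> into the image of \<open>\<rho>\<close>, so that \<open>[\<alpha>, \<beta>]\<close> is in
  \<open>B\<close> at a point where \<open>u \<noteq> 0\<close>: a contradiction.

  Bump functions are what makes all this possible: they provide \<open>u\<close> and sections of \<open>B\<close> through any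
  given vector (\<open>subbundle_section_through\<close>). They come from the flat function \<open>exp (-1/t)\<close>.
\<close>

section \<open>Calculus with iterated partial derivatives\<close>

lemma Euclidean_space_eq: "Euclidean_space n = top_of_set {x::nat\<Rightarrow>real. \<forall>i\<ge>n. x i = 0}"
  by (simp add: Euclidean_space_def flip: euclidean_product_topology)

text \<open>
  A partial derivative at a point of \<open>V\<close> looks at a coordinate line only; since a neighbourhood of
  the point on that line stays in \<open>V\<close>, all notions below depend on the values on \<open>V\<close> alone.
\<close>

lemma eventually_line_in_open:
  assumes V: "openin (Euclidean_space n) V" and x: "x \<in> V" and i: "i < n"
  shows "eventually (\<lambda>t. x(i := t) \<in> V) (nhds (x i))"
proof -
  obtain T where T: "open T" "V = {x. \<forall>i\<ge>n. x i = 0} \<inter> T"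
    using V by (auto simp: Euclidean_space_eq openin_open)
  have "continuous_on UNIV (\<lambda>t. x(i := t))"
  proof (rule continuous_on_coordinatewise_then_product)
    show "continuous_on UNIV (\<lambda>t. (x(i := t)) j)" for j by (cases "j = i") auto
  qed
  then have "open ((\<lambda>t. x(i := t)) -` T)"
    using T(1) open_vimage by blast
  moreover have "x i \<in> (\<lambda>t. x(i := t)) -` T" using x T by simp
  ultimately have "eventually (\<lambda>t. t \<in> (\<lambda>t. x(i := t)) -` T) (nhds (x i))"
    by (rule eventually_nhds_in_open)
  then show ?thesis
    by (rule eventually_mono) (use x T i in auto)
qed

lemma line_has_vector_derivative_cong:
  assumes V: "openin (Euclidean_space n) V" and x: "x \<in> V" and i: "i < n"
    and eq: "\<And>y. y \<in> V \<Longrightarrow> f y = g y"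
    and D: "((\<lambda>t. f (x(i := t))) has_vector_derivative D) (at (x i))"
  shows "((\<lambda>t. g (x(i := t))) has_vector_derivative D) (at (x i))"
proof -
  have "eventually (\<lambda>t. t \<in> UNIV \<longrightarrow> f (x(i := t)) = g (x(i := t))) (nhds (x i))"
    using eventually_line_in_open[OF V x i] by (rule eventually_mono) (simp add: eq)
  moreover have "f (x(i := x i)) = g (x(i := x i))" by (simp add: eq x)
  ultimately show ?thesis
    using D by (rule has_vector_derivative_cong_ev[THEN iffD1])
qed

lemma Ck_on_line_derivative:
  assumes "Ck_on n (Suc k) V f" "x \<in> V" "i < n"
  shows "((\<lambda>t. f (x(i := t))) has_vector_derivative partial_deriv i f x) (at (x i))"
  using assms by (auto simp: partial_deriv_def simp flip: vector_derivative_works)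

lemma partial_deriv_eqI:
  assumes "((\<lambda>t. f (x(i := t))) has_vector_derivative D) (at (x i))"
  shows "partial_deriv i f x = D"
  using assms by (simp add: partial_deriv_def vector_derivative_at)

lemma Ck_on_cong:
  assumes "openin (Euclidean_space n) V" "\<And>y. y \<in> V \<Longrightarrow> f y = g y" "Ck_on n k V f"
  shows "Ck_on n k V g"
  using assms(2,3)
proof (induction k arbitrary: f g)
  case 0
  then show ?case using continuous_on_cong by force
next
  case (Suc k)
  have D: "((\<lambda>t. g (x(i := t))) has_vector_derivative partial_deriv i f x) (at (x i))"
    if "x \<in> V" "i < n" for x i
    using line_has_vector_derivative_cong[OF assms(1) that] Suc.prems Ck_on_line_derivative[OF Suc.prems(2) that]
    by blast
  have "continuous_on V g" using Suc.prems continuous_on_cong by force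
  moreover have "Ck_on n k V (partial_deriv i g)" if "i < n" for i
  proof (rule Suc.IH)
    show "partial_deriv i f y = partial_deriv i g y" if "y \<in> V" for y
      using partial_deriv_eqI[OF D[OF that \<open>i < n\<close>]] by simp
    show "Ck_on n k V (partial_deriv i f)" using Suc.prems(2) that by simp
  qed
  moreover have "(\<lambda>t. g (x(i := t))) differentiable at (x i)" if "x \<in> V" "i < n" for x i
    using D[OF that] by (rule differentiableI_vector)
  ultimately show ?case by simp
qed

text \<open>
  The working form of the recursion: derivatives along the coordinate lines may be exhibited by any
  formula \<open>D\<close> valid on \<open>V\<close>, whereas \<^const>\<open>partial_deriv\<close> is a choice made on the whole space.
\<close>

lemma Ck_on_SucI:
  assumes V: "openin (Euclidean_space n) V" and "continuous_on V f"
    and D: "\<And>i x. i < n \<Longrightarrow> x \<in> V \<Longrightarrow> ((\<lambda>t. f (x(i := t))) has_vector_derivative D i x) (at (x i))"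
    and "\<And>i. i < n \<Longrightarrow> Ck_on n k V (D i)"
  shows "Ck_on n (Suc k) V f"
proof -
  have "Ck_on n k V (partial_deriv i f)" if "i < n" for i
    using V _ assms(4)[OF that] by (rule Ck_on_cong) (simp add: partial_deriv_eqI[OF D] that)
  then show ?thesis
    using assms(2) D by (auto intro: differentiableI_vector)
qed

lemma Ck_on_SucD: "Ck_on n (Suc k) V f \<Longrightarrow> Ck_on n k V f"
  by (induction k arbitrary: f) auto

lemma Ck_on_subset: "Ck_on n k V f \<Longrightarrow> V' \<subseteq> V \<Longrightarrow> Ck_on n k V' f"
  by (induction k arbitrary: f) (auto intro: continuous_on_subset)

lemma Ck_on_Union:
  assumes "\<And>V. V \<in> \<V> \<Longrightarrow> openin (Euclidean_space n) V" "\<And>V. V \<in> \<V> \<Longrightarrow> Ck_on n k V f"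
  shows "Ck_on n k (\<Union>\<V>) f"
proof -
  have *: "continuous_on (\<Union>\<V>) f" if cont: "\<And>V. V \<in> \<V> \<Longrightarrow> continuous_on V f" for f :: "(nat\<Rightarrow>real) \<Rightarrow> 'a"
  proof -
    have op: "openin (top_of_set (\<Union>\<V>)) V" if "V \<in> \<V>" for V
      using openin_subset_trans[OF assms(1)[OF that, unfolded Euclidean_space_eq], of "\<Union>\<V>"] that assms(1)
      by (auto simp: Euclidean_space_eq dest: openin_imp_subset)
    moreover have "\<Union>\<V> \<inter> V = V" if "V \<in> \<V>" for V using that by blast
    ultimately have "continuous_map (top_of_set (\<Union>\<V>)) euclidean f"
      using cont
      by - (rule pasting_lemma[where I = \<V> and T = "\<lambda>V. V" and f = "\<lambda>V. f"],
        auto simp: subtopology_subtopology)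
    then show ?thesis by simp
  qed
  show ?thesis using assms(2)
    by (induction k arbitrary: f) (auto intro!: *)
qed

lemma Ck_on_const:
  assumes "openin (Euclidean_space n) V" shows "Ck_on n k V (\<lambda>x. c)"
proof (induction k arbitrary: c)
  case (Suc k)
  show ?case
    by (rule Ck_on_SucI[OF assms, where D = "\<lambda>i x. 0"]) (auto intro: Suc.IH)
qed simp

lemma Ck_on_bounded_linear:
  assumes "openin (Euclidean_space n) V" "bounded_linear L" "Ck_on n k V f"
  shows "Ck_on n k V (\<lambda>x. L (f x))"
  using assms(3)
proof (induction k arbitrary: f)
  case 0
  then show ?case using assms(2) by (auto intro: bounded_linear.continuous_on)
next
  case (Suc k)
  show ?case
    by (rule Ck_on_SucI[OF assms(1), where D = "\<lambda>i x. L (partial_deriv i f x)"])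
      (use Suc assms(2) Ck_on_line_derivative[OF Suc.prems] in
       \<open>auto intro: bounded_linear.continuous_on bounded_linear.has_vector_derivative\<close>)
qed

lemma Ck_on_add:
  assumes "openin (Euclidean_space n) V" "Ck_on n k V f" "Ck_on n k V g"
  shows "Ck_on n k V (\<lambda>x. f x + g x)"
  using assms(2,3)
proof (induction k arbitrary: f g)
  case 0
  then show ?case by (auto intro: continuous_intros)
next
  case (Suc k)
  show ?case
    by (rule Ck_on_SucI[OF assms(1), where D = "\<lambda>i x. partial_deriv i f x + partial_deriv i g x"])
      (use Suc Ck_on_line_derivative[OF Suc.prems(1)] Ck_on_line_derivative[OF Suc.prems(2)] in
       \<open>auto intro: continuous_intros has_vector_derivative_add\<close>)
qed

lemma Ck_on_mult:
  fixes f g :: "_ \<Rightarrow> 'a::real_normed_algebra"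
  assumes "openin (Euclidean_space n) V" "Ck_on n k V f" "Ck_on n k V g"
  shows "Ck_on n k V (\<lambda>x. f x * g x)"
  using assms(2,3)
proof (induction k arbitrary: f g)
  case 0
  then show ?case by (auto intro: continuous_intros)
next
  case (Suc k)
  have fg: "Ck_on n k V f" "Ck_on n k V g" using Suc.prems Ck_on_SucD by blast+
  show ?case
  proof (rule Ck_on_SucI[OF assms(1), where D = "\<lambda>i x. f x * partial_deriv i g x + partial_deriv i f x * g x"])
    show "continuous_on V (\<lambda>x. f x * g x)" using Suc.prems by (auto intro: continuous_intros)
    show "((\<lambda>t. f (x(i := t)) * g (x(i := t))) has_vector_derivative
        f x * partial_deriv i g x + partial_deriv i f x * g x) (at (x i))" if "i < n" "x \<in> V" for i x
      using has_vector_derivative_mult[OF Ck_on_line_derivative[OF Suc.prems(1) that(2,1)]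
          Ck_on_line_derivative[OF Suc.prems(2) that(2,1)]] by (simp add: fun_upd_def)
    show "Ck_on n k V (\<lambda>x. f x * partial_deriv i g x + partial_deriv i f x * g x)" if "i < n" for i
      using Suc.prems that fg by (intro Ck_on_add[OF assms(1)] Suc.IH) auto
  qed
qed

text \<open>
  The only chain rule that is needed: bump functions are built from coordinate functions by algebra
  and by applying one function of a real variable. The sequence \<open>h\<close> lists that function and its
  successive derivatives.
\<close>

lemma Ck_on_compose_real:
  fixes f :: "_ \<Rightarrow> real" and h :: "nat \<Rightarrow> real \<Rightarrow> real"
  assumes "openin (Euclidean_space n) V" "Ck_on n k V f"
    and h: "\<And>j t. (h j has_real_derivative h (Suc j) t) (at t)"
  shows "Ck_on n k V (\<lambda>x. h j (f x))"
  using assms(2)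
proof (induction k arbitrary: j)
  case 0
  have "continuous_on UNIV (h j)"
    using h by (meson DERIV_isCont continuous_at_imp_continuous_on)
  then show ?case using 0 by (auto intro: continuous_on_compose2)
next
  case (Suc k)
  have c: "continuous_on UNIV (h j)"
    using h by (meson DERIV_isCont continuous_at_imp_continuous_on)
  show ?case
  proof (rule Ck_on_SucI[OF assms(1), where D = "\<lambda>i x. partial_deriv i f x * h (Suc j) (f x)"])
    show "continuous_on V (\<lambda>x. h j (f x))" using Suc.prems c by (auto intro: continuous_on_compose2)
    show "((\<lambda>t. h j (f (x(i := t)))) has_vector_derivative partial_deriv i f x * h (Suc j) (f x)) (at (x i))"
      if "i < n" "x \<in> V" for i x
      using field_vector_diff_chain_at[OF Ck_on_line_derivative[OF Suc.prems that(2,1)], of "h j" "h (Suc j) (f x)"]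
        h by (simp add: o_def fun_upd_def)
    show "Ck_on n k V (\<lambda>x. partial_deriv i f x * h (Suc j) (f x))" if "i < n" for i
      using Suc.prems that Suc.IH Ck_on_SucD[OF Suc.prems] by (intro Ck_on_mult[OF assms(1)]) auto
  qed
qed

text \<open>
  For \<open>p = 1\<close> this is the function \<open>exp (-1/t)\<close>, extended by \<open>0\<close>. Carrying an arbitrary polynomial
  in \<open>1/t\<close> as a factor makes the family closed under differentiation.
\<close>

definition flat :: "real poly \<Rightarrow> real \<Rightarrow> real" where
  "flat p t = (if t > 0 then poly p (1 / t) * exp (- (1 / t)) else 0)"

lemma poly_over_exp_tendsto_0: "((\<lambda>s. poly p s * exp (- s)) \<longlongrightarrow> (0::real)) at_top"
proof -
  have "((\<lambda>s. \<Sum>i\<le>degree p. coeff p i * (s ^ i / exp s)) \<longlongrightarrow> (\<Sum>i\<le>degree p. coeff p i * 0)) at_top"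
    by (intro tendsto_sum tendsto_mult tendsto_const tendsto_power_div_exp_0)
  then show ?thesis
    by (simp add: poly_altdef sum_distrib_right exp_minus divide_inverse mult.assoc)
qed

text \<open>
  Away from \<open>0\<close> this is the product rule. At \<open>0\<close> the difference quotient from the right is
  \<open>s p(s) exp (-s)\<close> with \<open>s = 1/t\<close>, and the exponential beats the polynomial.
\<close>

lemma flat_DERIV: "(flat p has_real_derivative flat ([:0, 0, 1:] * (p - pderiv p)) t) (at t)"
proof -
  consider "t > 0" | "t < 0" | "t = 0" by linarith
  then show ?thesis
  proof cases
    case 1
    have "((\<lambda>t. poly p (1 / t) * exp (- (1 / t))) has_real_derivative flat ([:0, 0, 1:] * (p - pderiv p)) t) (at t)"
      using 1 by (auto intro!: derivative_eq_intros DERIV_chain2[OF poly_DERIV]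
          simp: flat_def field_simps power2_eq_square)
    then show ?thesis
      by (rule has_field_derivative_transform_within_open[where S = "{0<..}"]) (use 1 in \<open>auto simp: flat_def\<close>)
  next
    case 2
    have "((\<lambda>t. 0) has_real_derivative flat ([:0, 0, 1:] * (p - pderiv p)) t) (at t)"
      using 2 by (simp add: flat_def)
    then show ?thesis
      by (rule has_field_derivative_transform_within_open[where S = "{..<0}"]) (use 2 in \<open>auto simp: flat_def\<close>)
  next
    case 3
    have "((\<lambda>t. poly (pCons 0 p) (1 / t) * exp (- (1 / t))) \<longlongrightarrow> 0) (at_right 0)"
      using filterlim_compose[OF poly_over_exp_tendsto_0 filterlim_inverse_at_top_right, of "pCons 0 p"]
      by (simp add: divide_inverse)
    then have "((\<lambda>t. flat p t / t) \<longlongrightarrow> 0) (at_right 0)"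
      by (rule Lim_transform_eventually)
         (auto simp: flat_def eventually_at_right_field divide_simps intro!: exI[of _ 1])
    moreover have "((\<lambda>t. flat p t / t) \<longlongrightarrow> 0) (at_left 0)"
      by (rule Lim_transform_eventually[OF tendsto_const])
         (auto simp: flat_def eventually_at_left_field intro!: exI[of _ "-1"])
    ultimately have "((\<lambda>t. flat p t / t) \<longlongrightarrow> 0) (at 0)"
      by (simp add: filterlim_at_split)
    then show ?thesis
      using 3 by (simp add: has_field_derivative_iff flat_def)
  qed
qed

lemma Ck_on_flat:
  assumes "openin (Euclidean_space n) V" "Ck_on n k V f"
  shows "Ck_on n k V (\<lambda>x. flat p (f x))"
proof -
  let ?h = "\<lambda>j. flat (((\<lambda>p. [:0, 0, 1:] * (p - pderiv p)) ^^ j) p)"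
  have "Ck_on n k V (\<lambda>x. ?h 0 (f x))"
    using assms flat_DERIV by (intro Ck_on_compose_real[where h = ?h]) auto
  then show ?thesis by simp
qed

section \<open>Smooth functions on a manifold and bump functions\<close>

context smooth_manifold
begin

lemma chart_open: "(U, \<psi>) \<in> charts M \<Longrightarrow> open U"
  using chart by (auto simp: is_chart_def)

lemma chart_inj: "(U, \<psi>) \<in> charts M \<Longrightarrow> inj_on \<psi> U"
  using chart[of U \<psi>] homeomorphic_imp_injective_map[of "top_of_set U" _ \<psi>]
  by (auto simp: is_chart_def)

lemma chart_image_open:
  assumes "(U, \<psi>) \<in> charts M" "open W"
  shows "openin (Euclidean_space (mfd_dim M)) (\<psi> ` (U \<inter> W))"
proof -
  have "open_map (top_of_set U) (subtopology (Euclidean_space (mfd_dim M)) (\<psi> ` U)) \<psi>"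
    using chart[OF assms(1)] by (auto simp: is_chart_def intro: homeomorphic_imp_open_map)
  moreover have "openin (top_of_set U) (U \<inter> W)" using assms(2) by (auto simp: openin_open)
  ultimately have "openin (subtopology (Euclidean_space (mfd_dim M)) (\<psi> ` U)) (\<psi> ` (U \<inter> W))"
    by (simp add: open_map_def)
  then show ?thesis
    using chart[OF assms(1)] openin_trans_full by (auto simp: is_chart_def)
qed

lemma chart_inverse_continuous:
  assumes "(U, \<psi>) \<in> charts M"
  shows "continuous_on (\<psi> ` U) (inv_into U \<psi>)"
proof -
  have "openin (top_of_set (\<psi> ` U)) (\<psi> ` T)" if T: "openin (top_of_set U) T" for T
  proof -
    have "open T" "U \<inter> T = T"
      using T chart_open[OF assms] openin_open_eq by auto
    then have "openin (Euclidean_space (mfd_dim M)) (\<psi> ` T)"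
      using chart_image_open[OF assms, of T] by simp
    moreover have "openin (Euclidean_space (mfd_dim M)) (\<psi> ` U)"
      using chart_image_open[OF assms open_UNIV] by simp
    ultimately show ?thesis
      unfolding Euclidean_space_eq
      using openin_subset_trans[OF _ image_mono] openin_imp_subset T by meson
  qed
  moreover have "continuous_on U \<psi>"
  proof -
    have "continuous_map (top_of_set U) (subtopology (Euclidean_space (mfd_dim M)) (\<psi> ` U)) \<psi>"
      using chart[OF assms] homeomorphic_imp_continuous_map by (auto simp: is_chart_def)
    then show ?thesis
      by (simp add: Euclidean_space_eq subtopology_subtopology continuous_map_in_subtopology)
  qed
  ultimately show ?thesis
    using chart_inj[OF assms] by - (rule continuous_on_inverse_open_map[where f = \<psi> and S = U], auto)
qed

lemma smooth_onI:
  "(\<And>U \<psi> k. (U, \<psi>) \<in> charts M \<Longrightarrow> Ck_on (mfd_dim M) k (\<psi> ` (U \<inter> W)) (\<lambda>y. f (inv_into U \<psi> y)))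
    \<Longrightarrow> smooth_on M W f"
  by (auto simp: smooth_on_def Cinf_on_def)

lemma smooth_onD:
  "smooth_on M W f \<Longrightarrow> (U, \<psi>) \<in> charts M \<Longrightarrow>
    Ck_on (mfd_dim M) k (\<psi> ` (U \<inter> W)) (\<lambda>y. f (inv_into U \<psi> y))"
  by (auto simp: smooth_on_def Cinf_on_def)

lemma smooth_on_cong:
  assumes "open W" "\<And>x. x \<in> W \<Longrightarrow> f x = g x" "smooth_on M W f"
  shows "smooth_on M W g"
proof (rule smooth_onI)
  fix U \<psi> k assume c: "(U, \<psi>) \<in> charts M"
  have "f (inv_into U \<psi> y) = g (inv_into U \<psi> y)" if "y \<in> \<psi> ` (U \<inter> W)" for y
    using that assms(2) chart_inj[OF c] by auto
  then show "Ck_on (mfd_dim M) k (\<psi> ` (U \<inter> W)) (\<lambda>y. g (inv_into U \<psi> y))"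
    using smooth_onD[OF assms(3) c] by (rule Ck_on_cong[OF chart_image_open[OF c assms(1)]])
qed

lemma smooth_on_subset:
  assumes "smooth_on M W f" "W' \<subseteq> W" shows "smooth_on M W' f"
proof (rule smooth_onI)
  fix U \<psi> k assume c: "(U, \<psi>) \<in> charts M"
  show "Ck_on (mfd_dim M) k (\<psi> ` (U \<inter> W')) (\<lambda>y. f (inv_into U \<psi> y))"
    using smooth_onD[OF assms(1) c] by (rule Ck_on_subset) (use assms(2) in blast)
qed

lemma smooth_on_Union:
  assumes "\<And>W. W \<in> \<W> \<Longrightarrow> open W" "\<And>W. W \<in> \<W> \<Longrightarrow> smooth_on M W f"
  shows "smooth_on M (\<Union>\<W>) f"
proof (rule smooth_onI)
  fix U \<psi> k assume c: "(U, \<psi>) \<in> charts M"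
  have "Ck_on (mfd_dim M) k (\<Union>((\<lambda>W. \<psi> ` (U \<inter> W)) ` \<W>)) (\<lambda>y. f (inv_into U \<psi> y))"
  proof (rule Ck_on_Union)
    show "openin (Euclidean_space (mfd_dim M)) V" if "V \<in> (\<lambda>W. \<psi> ` (U \<inter> W)) ` \<W>" for V
      using that chart_image_open[OF c] assms(1) by auto
    show "Ck_on (mfd_dim M) k V (\<lambda>y. f (inv_into U \<psi> y))" if "V \<in> (\<lambda>W. \<psi> ` (U \<inter> W)) ` \<W>" for V
      using that smooth_onD[OF assms(2) c] by auto
  qed
  moreover have "\<psi> ` (U \<inter> \<Union>\<W>) = \<Union>((\<lambda>W. \<psi> ` (U \<inter> W)) ` \<W>)" by blast
  ultimately show "Ck_on (mfd_dim M) k (\<psi> ` (U \<inter> \<Union>\<W>)) (\<lambda>y. f (inv_into U \<psi> y))" by simp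
qed

lemma smooth_on_locally:
  assumes "open W" "\<And>x. x \<in> W \<Longrightarrow> \<exists>W'. open W' \<and> x \<in> W' \<and> smooth_on M (W \<inter> W') f"
  shows "smooth_on M W f"
proof -
  have "smooth_on M (\<Union>{W'. open W' \<and> W' \<subseteq> W \<and> smooth_on M W' f}) f"
    by (rule smooth_on_Union) auto
  moreover have "W \<subseteq> \<Union>{W'. open W' \<and> W' \<subseteq> W \<and> smooth_on M W' f}"
  proof
    fix x assume "x \<in> W"
    with assms obtain W' where "open W'" "x \<in> W'" "smooth_on M (W \<inter> W') f" by blast
    with \<open>x \<in> W\<close> assms(1) show "x \<in> \<Union>{W'. open W' \<and> W' \<subseteq> W \<and> smooth_on M W' f}"
      by (intro UnionI[of "W \<inter> W'"]) auto
  qed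
  ultimately show ?thesis by (rule smooth_on_subset)
qed

lemma smooth_on_const:
  assumes "open W" shows "smooth_on M W (\<lambda>x. c)"
  by (rule smooth_onI) (rule Ck_on_const[OF chart_image_open[OF _ assms]])

lemma smooth_on_zero:
  assumes "open W" "\<And>x. x \<in> W \<Longrightarrow> f x = 0" shows "smooth_on M W f"
  using assms(1) _ smooth_on_const[OF assms(1), of 0] by (rule smooth_on_cong) (simp add: assms(2))

lemma smooth_on_bounded_linear:
  assumes "open W" "bounded_linear L" "smooth_on M W f"
  shows "smooth_on M W (\<lambda>x. L (f x))"
proof (rule smooth_onI)
  fix U \<psi> k assume c: "(U, \<psi>) \<in> charts M"
  show "Ck_on (mfd_dim M) k (\<psi> ` (U \<inter> W)) (\<lambda>y. L (f (inv_into U \<psi> y)))"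
    using chart_image_open[OF c assms(1)] assms(2) smooth_onD[OF assms(3) c]
    by (rule Ck_on_bounded_linear)
qed

lemma smooth_on_add:
  assumes "open W" "smooth_on M W f" "smooth_on M W g"
  shows "smooth_on M W (\<lambda>x. f x + g x)"
proof (rule smooth_onI)
  fix U \<psi> k assume c: "(U, \<psi>) \<in> charts M"
  show "Ck_on (mfd_dim M) k (\<psi> ` (U \<inter> W)) (\<lambda>y. f (inv_into U \<psi> y) + g (inv_into U \<psi> y))"
    using chart_image_open[OF c assms(1)] smooth_onD[OF assms(2) c] smooth_onD[OF assms(3) c]
    by (rule Ck_on_add)
qed

lemma smooth_on_mult:
  fixes f g :: "'m \<Rightarrow> 'a::real_normed_algebra"
  assumes "open W" "smooth_on M W f" "smooth_on M W g"
  shows "smooth_on M W (\<lambda>x. f x * g x)"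
proof (rule smooth_onI)
  fix U \<psi> k assume c: "(U, \<psi>) \<in> charts M"
  show "Ck_on (mfd_dim M) k (\<psi> ` (U \<inter> W)) (\<lambda>y. f (inv_into U \<psi> y) * g (inv_into U \<psi> y))"
    using chart_image_open[OF c assms(1)] smooth_onD[OF assms(2) c] smooth_onD[OF assms(3) c]
    by (rule Ck_on_mult)
qed

lemma smooth_on_flat:
  assumes "open W" "smooth_on M W f"
  shows "smooth_on M W (\<lambda>x. flat p (f x))"
proof (rule smooth_onI)
  fix U \<psi> k assume c: "(U, \<psi>) \<in> charts M"
  show "Ck_on (mfd_dim M) k (\<psi> ` (U \<inter> W)) (\<lambda>y. flat p (f (inv_into U \<psi> y)))"
    using chart_image_open[OF c assms(1)] smooth_onD[OF assms(2) c]
    by (rule Ck_on_flat)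
qed

lemma smooth_on_sum:
  assumes "open W" "\<And>i. i \<in> I \<Longrightarrow> smooth_on M W (f i)"
  shows "smooth_on M W (\<lambda>x. \<Sum>i\<in>I. f i x)"
  using assms(2)
  by (induction I rule: infinite_finite_induct) (simp_all add: smooth_on_const smooth_on_add assms(1))

lemma smooth_on_prod:
  fixes f :: "'i \<Rightarrow> 'm \<Rightarrow> 'a::{real_normed_algebra, comm_ring_1}"
  assumes "open W" "\<And>i. i \<in> I \<Longrightarrow> smooth_on M W (f i)"
  shows "smooth_on M W (\<lambda>x. \<Prod>i\<in>I. f i x)"
  using assms(2)
  by (induction I rule: infinite_finite_induct) (simp_all add: smooth_on_const smooth_on_mult assms(1))

lemma smooth_on_chart_coordinate:
  assumes "(U, \<psi>) \<in> charts M" "i < mfd_dim M"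
  shows "smooth_on M U (\<lambda>x. \<psi> x i)"
proof (rule smooth_onI)
  fix V \<phi> k assume "(V, \<phi>) \<in> charts M"
  then show "Ck_on (mfd_dim M) k (\<phi> ` (V \<inter> U)) (\<lambda>y. \<psi> (inv_into V \<phi> y) i)"
    using charts_compatible[OF _ assms, of V \<phi>] by (simp add: Cinf_on_def)
qed

text \<open>
  The two open sets \<open>U\<close> and \<open>- K\<close> cover the manifold, and the extended function is smooth on each.
\<close>

lemma smooth_on_extend_zero:
  fixes f :: "'m \<Rightarrow> 'v::real_normed_vector"
  assumes "open U" "closed K" "K \<subseteq> U" "smooth_on M U f" "\<And>x. x \<in> U - K \<Longrightarrow> f x = 0"
  shows "smooth_on M UNIV (\<lambda>x. if x \<in> U then f x else 0)"
proof -
  have "smooth_on M (\<Union>{U, - K}) (\<lambda>x. if x \<in> U then f x else 0)"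
  proof (rule smooth_on_Union)
    have "smooth_on M U (\<lambda>x. if x \<in> U then f x else 0)"
      using assms(1) _ assms(4) by (rule smooth_on_cong) simp
    moreover have "smooth_on M (- K) (\<lambda>x. if x \<in> U then f x else 0)"
      using _ _ smooth_on_const[of "- K" 0] by (rule smooth_on_cong) (use assms in auto)
    ultimately show "smooth_on M W (\<lambda>x. if x \<in> U then f x else 0)" if "W \<in> {U, - K}" for W
      using that by auto
  qed (use assms in auto)
  moreover have "\<Union>{U, - K} = UNIV" using assms(3) by blast
  ultimately show ?thesis by simp
qed

end

text \<open>
  The cube is flat in the directions \<open>i \<ge> n\<close>; this makes it a product of compact intervals and
  points.
\<close>

lemma openin_Euclidean_space_contains_cube:
  assumes V: "openin (Euclidean_space n) V" and p: "p \<in> V"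
  obtains \<epsilon> where "\<epsilon> > 0" "{y. (\<forall>i\<ge>n. y i = 0) \<and> (\<forall>i<n. \<bar>y i - p i\<bar> \<le> \<epsilon>)} \<subseteq> V"
proof -
  obtain T where T: "open T" "V = {x. \<forall>i\<ge>n. x i = 0} \<inter> T"
    using V by (auto simp: Euclidean_space_eq openin_open)
  have "openin (product_topology (\<lambda>i::nat. euclidean) UNIV) T"
    using T(1) by (simp add: euclidean_product_topology)
  then obtain X where X: "p \<in> (\<Pi>\<^sub>E i\<in>UNIV. X i)" "\<And>i. open (X i)" "(\<Pi>\<^sub>E i\<in>UNIV. X i) \<subseteq> T"
    using product_topology_open_contains_basis[of "\<lambda>i::nat. euclidean" UNIV T p] p T(2) by auto
  have "\<exists>e>0. cball (p i) e \<subseteq> X i" for i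
    using X(1,2) open_contains_cball by blast
  then obtain e where e: "\<And>i. e i > 0" "\<And>i. cball (p i) (e i) \<subseteq> X i" by metis
  \<comment> \<open>The element \<open>1\<close> keeps the minimum defined for \<open>n = 0\<close>.\<close>
  define \<epsilon> where "\<epsilon> = Min (insert 1 (e ` {..<n}))"
  have "\<epsilon> > 0" using e(1) by (simp add: \<epsilon>_def)
  moreover have "y \<in> V" if y: "\<forall>i\<ge>n. y i = 0" "\<forall>i<n. \<bar>y i - p i\<bar> \<le> \<epsilon>" for y
  proof -
    have "y i \<in> X i" for i
    proof (cases "i < n")
      case True
      then have "\<epsilon> \<le> e i" by (simp add: \<epsilon>_def)
      then have "y i \<in> cball (p i) (e i)"
        using y(2) True by (force simp: dist_real_def abs_minus_commute)
      then show ?thesis using e(2) by blast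
    next
      case False
      then have "y i = p i" using y(1) p T(2) by simp
      then show ?thesis using X(1) by auto
    qed
    then show ?thesis using y(1) X(3) T(2) by auto
  qed
  ultimately show thesis using that by blast
qed

lemma compact_cube:
  "compact {y::nat\<Rightarrow>real. (\<forall>i\<ge>n. y i = 0) \<and> (\<forall>i<n. \<bar>y i - p i\<bar> \<le> \<epsilon>)}"
proof -
  have "((\<forall>i\<ge>n. y i = 0) \<and> (\<forall>i<n. \<bar>y i - p i\<bar> \<le> \<epsilon>)) \<longleftrightarrow>
      (\<forall>i. y i \<in> (if i < n then {p i - \<epsilon>..p i + \<epsilon>} else {0}))"
    (is "?L \<longleftrightarrow> ?R") for y :: "nat \<Rightarrow> real"
  proof
    assume ?L
    then show ?R by (auto simp: abs_diff_le_iff)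
  next
    assume R: ?R
    have "y i = 0" if "n \<le> i" for i using R[rule_format, of i] that by simp
    moreover have "\<bar>y i - p i\<bar> \<le> \<epsilon>" if "i < n" for i
      using R[rule_format, of i] that by (simp add: abs_diff_le_iff)
    ultimately show ?L by blast
  qed
  then have "{y. (\<forall>i\<ge>n. y i = 0) \<and> (\<forall>i<n. \<bar>y i - p i\<bar> \<le> \<epsilon>)} =
        (\<Pi>\<^sub>E i\<in>UNIV. if i < n then {p i - \<epsilon>..p i + \<epsilon>} else {0})"
    by (simp only: PiE_UNIV_domain Pi_def UNIV_I simp_thms)
  moreover have "compactin (product_topology (\<lambda>i::nat. euclidean) UNIV)
      (\<Pi>\<^sub>E i\<in>UNIV. if i < n then {p i - \<epsilon>..p i + \<epsilon>} else {0})"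
    by (simp add: compactin_PiE)
  ultimately show ?thesis
    by (simp add: euclidean_product_topology)
qed

context smooth_manifold
begin

text \<open>
  In a chart, the product over the coordinates of \<open>exp (-1/(\<epsilon>\<^sup>2 - (y\<^sub>i - p\<^sub>i)\<^sup>2))\<close> lives on a cube.
  The preimage \<open>K\<close> of the closed cube is compact, hence closed because the manifold is Hausdorff, and
  so the function extends by zero.
\<close>

lemma bump_function:
  assumes "open W" "x \<in> W"
  obtains h :: "'m \<Rightarrow> real" and K
  where "smooth_on M UNIV h" "h x \<noteq> 0" "closed K" "K \<subseteq> W" "\<And>y. y \<notin> K \<Longrightarrow> h y = 0"
proof -
  obtain U \<psi> where c: "(U, \<psi>) \<in> charts M" and xU: "x \<in> U"
  proof -
    have "x \<in> (\<Union>(U, \<psi>)\<in>charts M. U)" using charts_cover by simp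
    then show ?thesis using that by auto
  qed
  let ?n = "mfd_dim M"
  define p where "p = \<psi> x"
  have "p \<in> \<psi> ` (U \<inter> W)" using xU assms(2) by (auto simp: p_def)
  with openin_Euclidean_space_contains_cube[OF chart_image_open[OF c assms(1)]]
  obtain \<epsilon> where \<epsilon>: "\<epsilon> > 0"
    and cube: "{y. (\<forall>i\<ge>?n. y i = 0) \<and> (\<forall>i<?n. \<bar>y i - p i\<bar> \<le> \<epsilon>)} \<subseteq> \<psi> ` (U \<inter> W)"
    by blast
  let ?C = "{y. (\<forall>i\<ge>?n. y i = 0) \<and> (\<forall>i<?n. \<bar>y i - p i\<bar> \<le> \<epsilon>)}"
  define K where "K = inv_into U \<psi> ` ?C"
  have "compact K"
    unfolding K_def
    by (intro compact_continuous_image compact_cube continuous_on_subset[OF chart_inverse_continuous[OF c]])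
      (use cube in blast)
  then have K: "closed K" by (rule compact_imp_closed)
  have KW: "K \<subseteq> U \<inter> W"
    using cube chart_inj[OF c] by (auto simp: K_def)
  define h where "h = (\<lambda>y. \<Prod>i<?n. flat [:1:] (\<epsilon>\<^sup>2 - (\<psi> y i - p i)\<^sup>2))"
  have sm: "smooth_on M U h"
  proof -
    have "smooth_on M U (\<lambda>y. \<epsilon>\<^sup>2 + - ((\<psi> y i + - p i) * (\<psi> y i + - p i)))" if "i < ?n" for i
      by (intro smooth_on_add smooth_on_const smooth_on_mult smooth_on_chart_coordinate[OF c that] chart_open[OF c]
        smooth_on_bounded_linear[OF _ bounded_linear_minus[OF bounded_linear_ident]])
    then have "smooth_on M U (\<lambda>y. \<epsilon>\<^sup>2 - (\<psi> y i - p i)\<^sup>2)" if "i < ?n" for i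
      using that by (simp add: power2_eq_square)
    then show ?thesis
      unfolding h_def by (intro smooth_on_prod smooth_on_flat chart_open[OF c]) auto
  qed
  have h0: "h y = 0" if "y \<in> U - K" for y
  proof -
    have "\<psi> y \<in> topspace (Euclidean_space ?n)"
      using openin_subset[OF chart_image_open[OF c open_UNIV]] that by auto
    then have "\<psi> y \<notin> ?C \<Longrightarrow> \<exists>i<?n. \<bar>\<psi> y i - p i\<bar> > \<epsilon>"
      by (auto simp: topspace_Euclidean_space not_le)
    moreover have "\<psi> y \<notin> ?C"
      using that chart_inj[OF c] by (auto simp: K_def intro!: image_eqI[of _ _ "\<psi> y"])
    ultimately obtain i where "i < ?n" "\<bar>\<psi> y i - p i\<bar> > \<epsilon>" by blast
    then have "flat [:1:] (\<epsilon>\<^sup>2 - (\<psi> y i - p i)\<^sup>2) = 0"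
      using \<epsilon> by (simp add: flat_def abs_le_square_iff[symmetric] not_less)
    then show ?thesis using \<open>i < ?n\<close> by (auto simp: h_def)
  qed
  have "h x \<noteq> 0" using \<epsilon> by (simp add: h_def p_def flat_def)
  show thesis
  proof (rule that[of "\<lambda>y. if y \<in> U then h y else 0" K])
    show "smooth_on M UNIV (\<lambda>y. if y \<in> U then h y else 0)"
      using smooth_on_extend_zero[OF chart_open[OF c] K _ sm] KW h0 by blast
  qed (use K KW h0 xU \<open>h x \<noteq> 0\<close> in auto)
qed

end

section \<open>Vector bundles, their sections and subbundles\<close>

text \<open>
  More vectors than coordinates are linearly dependent: induction on the set of coordinates, using
  one vector \<open>p\<close> with nonzero entry at the new coordinate to clear that entry of all others.
\<close>

lemma exists_linear_relation:
  fixes Z :: "'i \<Rightarrow> 'l \<Rightarrow> 'a::field"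
  assumes "finite D" "finite I" "card D < card I"
  shows "\<exists>c. (\<exists>i\<in>I. c i \<noteq> 0) \<and> (\<forall>l\<in>D. (\<Sum>i\<in>I. c i * Z i l) = 0)"
  using assms
proof (induction D arbitrary: I Z rule: finite_induct)
  case empty
  then show ?case by (auto intro!: exI[of _ "\<lambda>_. 1"] simp: card_gt_0_iff)
next
  case (insert l0 D)
  show ?case
  proof (cases "\<forall>i\<in>I. Z i l0 = 0")
    case True
    then show ?thesis
      using insert.IH[of I Z] insert.prems insert.hyps by auto
  next
    case False
    then obtain p where p: "p \<in> I" "Z p l0 \<noteq> 0" by blast
    let ?I = "I - {p}"
    have "card D < card ?I" using insert.prems insert.hyps p(1) by simp
    from insert.IH[OF _ this, of "\<lambda>i l. Z i l - Z i l0 / Z p l0 * Z p l"] insert.prems(1)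
    obtain c where c: "\<exists>i\<in>?I. c i \<noteq> 0"
      and rel: "\<And>l. l \<in> D \<Longrightarrow> (\<Sum>i\<in>?I. c i * (Z i l - Z i l0 / Z p l0 * Z p l)) = 0"
      by auto
    \<comment> \<open>The coefficient of the pivot vector restores the relation at \<open>l0\<close>.\<close>
    define d where "d = c(p := - (\<Sum>i\<in>?I. c i * Z i l0) / Z p l0)"
    have split: "(\<Sum>i\<in>I. d i * Z i l) = d p * Z p l + (\<Sum>i\<in>?I. c i * Z i l)" for l
      using insert.prems(1) p(1) by (simp add: sum.remove[of I p] d_def)
    have "(\<Sum>i\<in>I. d i * Z i l) = 0" if "l \<in> D" for l
      using rel[OF that] unfolding split
      by (simp add: d_def algebra_simps sum_subtractf sum_distrib_left sum_distrib_right sum_divide_distrib)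
    moreover have "(\<Sum>i\<in>I. d i * Z i l0) = 0"
      unfolding split using p(2) by (simp add: d_def)
    moreover have "\<exists>i\<in>I. d i \<noteq> 0" using c by (auto simp: d_def)
    ultimately show ?thesis by (intro exI[of _ d]) auto
  qed
qed

text \<open>
  A multiple of the identity matrix of size \<open>r\<close> cannot factor through dimension \<open>d < r\<close>: pairing
  a linear relation between the rows of \<open>Z\<close> with the rows of \<open>C\<close> shows that its coefficients vanish.
\<close>

lemma dual_system_card_le:
  fixes Z :: "nat \<Rightarrow> nat \<Rightarrow> 'a::field"
  assumes "g \<noteq> 0" and dual: "\<And>i j. i < r \<Longrightarrow> j < r \<Longrightarrow> (\<Sum>l<d. Z i l * C j l) = (if i = j then g else 0)"
  shows "r \<le> d"
proof (rule ccontr)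
  assume "\<not> r \<le> d"
  then obtain c k where c: "k < r" "c k \<noteq> 0" "\<And>l. l < d \<Longrightarrow> (\<Sum>i<r. c i * Z i l) = 0"
    using exists_linear_relation[of "{..<d}" "{..<r}" Z] by auto
  have "0 = (\<Sum>l<d. (\<Sum>i<r. c i * Z i l) * C k l)" using c(3) by simp
  also have "\<dots> = (\<Sum>i<r. c i * (\<Sum>l<d. Z i l * C k l))"
    by (simp add: sum_distrib_left sum_distrib_right mult.assoc) (rule sum.swap)
  also have "\<dots> = (\<Sum>i<r. if i = k then c i * g else 0)"
    using c(1) by (intro sum.cong) (auto simp: dual)
  also have "\<dots> = c k * g" using c(1) by simp
  finally show False using c(2) assms(1) by simp
qed

lemma fibrewise_isoD:
  assumes "fibrewise_iso A U r \<phi>" "x \<in> U"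
  shows "bij_betw \<phi> (fibre A x) (cspace r)" "\<phi> (fib_zero A x) = (\<lambda>i. 0)"
    "\<And>a b. a \<in> fibre A x \<Longrightarrow> b \<in> fibre A x \<Longrightarrow> \<phi> (fib_add A a b) = (\<lambda>i. \<phi> a i + \<phi> b i)"
    "\<And>a c. a \<in> fibre A x \<Longrightarrow> \<phi> (fib_scale A c a) = (\<lambda>i. c * \<phi> a i)"
  using assms by (auto simp: fibrewise_iso_def)

lemma fibrewise_iso_inv:
  assumes "fibrewise_iso A U r \<phi>" "x \<in> U" "z \<in> cspace r"
  shows "inv_into (fibre A x) \<phi> z \<in> fibre A x" "\<phi> (inv_into (fibre A x) \<phi> z) = z"
proof -
  have "z \<in> \<phi> ` fibre A x" using fibrewise_isoD(1)[OF assms(1,2)] assms(3) by (simp add: bij_betw_def)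
  then show "inv_into (fibre A x) \<phi> z \<in> fibre A x" "\<phi> (inv_into (fibre A x) \<phi> z) = z"
    by (rule inv_into_into, rule f_inv_into_f)
qed

lemma fibrewise_iso_coord_0:
  assumes "fibrewise_iso A U r \<phi>" "x \<in> U" "e \<in> fibre A x" "r \<le> i"
  shows "\<phi> e i = 0"
  using fibrewise_isoD(1)[OF assms(1,2)] assms(3,4) by (auto simp: bij_betw_def cspace_def)

lemma fibrewise_iso_eqI:
  assumes "fibrewise_iso A U r \<phi>" "x \<in> U" "a \<in> fibre A x" "b \<in> fibre A x" "\<phi> a = \<phi> b"
  shows "a = b"
  using fibrewise_isoD(1)[OF assms(1,2)] assms(3-5) by (auto simp: bij_betw_def dest: inj_onD)

lemma cspace_mono: "k \<le> r \<Longrightarrow> z \<in> cspace k \<Longrightarrow> z \<in> cspace r"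
  by (auto simp: cspace_def)

lemma cunit_cspace: "j < r \<Longrightarrow> cunit j \<in> cspace r"
  by (auto simp: cunit_def cspace_def)

context complex_vector_bundle
begin

text \<open>
  A linear functional on a fibre is determined by its values on the frame of a trivialization. This is used for the
  coordinates in another trivialization and for the anchor followed by evaluation at a function.
\<close>

lemma linear_functional_expansion:
  assumes \<phi>: "fibrewise_iso A U r \<phi>" and x: "x \<in> U"
    and add: "\<And>a b. a \<in> fibre A x \<Longrightarrow> b \<in> fibre A x \<Longrightarrow> L (fib_add A a b) = L a + L b"
    and scale: "\<And>a c. a \<in> fibre A x \<Longrightarrow> L (fib_scale A c a) = c * L a"
    and e: "e \<in> fibre A x"
  shows "L e = (\<Sum>l<r. \<phi> e l * L (inv_into (fibre A x) \<phi> (cunit l)))"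
proof -
  let ?J = "inv_into (fibre A x) \<phi>"
  note J = fibrewise_iso_inv[OF \<phi> x]
  note D = fibrewise_isoD[OF \<phi> x]
  have "L (?J z) = (\<Sum>l<m. z l * L (?J (cunit l)))" if "z \<in> cspace m" "m \<le> r" for z m
    using that
  proof (induction m arbitrary: z)
    case 0
    then have z: "z \<in> cspace r" "z = (\<lambda>i. 0)" by (auto simp: cspace_def)
    \<comment> \<open>The zero vector is its own multiple by \<open>0\<close>, so \<open>L\<close> vanishes on it.\<close>
    have "?J z = fib_scale A 0 (?J z)"
      by (rule fibrewise_iso_eqI[OF \<phi> x]) (use z J D fib_scale_closed in auto)
    then have "L (?J z) = 0 * L (?J z)" using scale[OF J(1)[OF z(1)], of 0] by simp
    then show ?case by simp
  next
    case (Suc m)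
    define z' where "z' = z(m := 0)"
    have z': "z' \<in> cspace m" using Suc.prems(1) by (auto simp: z'_def cspace_def le_Suc_eq)
    have in_r: "z \<in> cspace r" "z' \<in> cspace r" "cunit m \<in> cspace r"
      using Suc.prems z' cspace_mono[of m r z'] cspace_mono[of "Suc m" r z] by (auto intro: cunit_cspace)
    have cl: "fib_scale A (z m) (?J (cunit m)) \<in> fibre A x"
      using J(1)[OF in_r(3)] by (rule fib_scale_closed)
    have "?J z = fib_add A (?J z') (fib_scale A (z m) (?J (cunit m)))"
      by (rule fibrewise_iso_eqI[OF \<phi> x])
        (use J in_r cl D fib_add_closed in \<open>auto simp: z'_def cunit_def\<close>)
    then have "L (?J z) = L (?J z') + z m * L (?J (cunit m))"
      using add[OF J(1)[OF in_r(2)] cl] scale[OF J(1)[OF in_r(3)]] by simp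
    also have "L (?J z') = (\<Sum>l<m. z l * L (?J (cunit l)))"
    proof -
      have "L (?J z') = (\<Sum>l<m. z' l * L (?J (cunit l)))" using Suc.IH[OF z'] Suc.prems(2) by simp
      also have "\<dots> = (\<Sum>l<m. z l * L (?J (cunit l)))" by (rule sum.cong) (auto simp: z'_def)
      finally show ?thesis .
    qed
    finally show ?case by simp
  qed
  moreover have "\<phi> e \<in> cspace r" using D(1) e by (auto simp: bij_betw_def)
  moreover have "?J (\<phi> e) = e" using D(1) e by (simp add: bij_betw_def)
  ultimately show ?thesis by (metis order_refl)
qed

lemma dual_system_le_rank:
  fixes L :: "nat \<Rightarrow> 'e \<Rightarrow> complex" and e :: "nat \<Rightarrow> 'e"
  assumes \<phi>: "fibrewise_iso A U r \<phi>" and x: "x \<in> U"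
    and add: "\<And>j a b. a \<in> fibre A x \<Longrightarrow> b \<in> fibre A x \<Longrightarrow> L j (fib_add A a b) = L j a + L j b"
    and scale: "\<And>j a c. a \<in> fibre A x \<Longrightarrow> L j (fib_scale A c a) = c * L j a"
    and e: "\<And>i. i < n \<Longrightarrow> e i \<in> fibre A x"
    and g: "g \<noteq> 0" and dual: "\<And>i j. i < n \<Longrightarrow> j < n \<Longrightarrow> L j (e i) = (if i = j then g else 0)"
  shows "n \<le> r"
proof (rule dual_system_card_le[OF g])
  fix i j assume ij: "i < n" "j < n"
  show "(\<Sum>l<r. \<phi> (e i) l * L j (inv_into (fibre A x) \<phi> (cunit l))) = (if i = j then g else 0)"
    using linear_functional_expansion[where L = "L j", OF \<phi> x add scale e[OF ij(1)]] dual[OF ij] by simp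
qed

text \<open>
  Coordinates transform by the matrix of the transition map, whose entries are smooth.
\<close>

lemma smooth_coordinate_change:
  assumes \<phi>: "fibrewise_iso A U r \<phi>" and \<psi>: "fibrewise_iso A V s \<psi>"
    and tr: "smooth_transition M A (U, r, \<phi>) (V, s, \<psi>)"
    and W: "open W" "W \<subseteq> U \<inter> V"
    and \<alpha>: "\<And>x. x \<in> W \<Longrightarrow> \<alpha> x \<in> fibre A x"
    and sm: "\<And>l. l < r \<Longrightarrow> smooth_on M W (\<lambda>x. \<phi> (\<alpha> x) l)"
  shows "smooth_on M W (\<lambda>x. \<psi> (\<alpha> x) i)"
proof (cases "i < s")
  case True
  let ?T = "\<lambda>l x. \<psi> (inv_into (fibre A x) \<phi> (cunit l)) i"
  have "smooth_on M W (?T l)" if "l < r" for l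
    using tr that True smooth_on_subset[OF _ W(2)] by (auto simp: smooth_transition_def)
  then have sum: "smooth_on M W (\<lambda>x. \<Sum>l<r. \<phi> (\<alpha> x) l * ?T l x)"
    using W(1) sm by (intro smooth_on_sum smooth_on_mult) auto
  have "(\<Sum>l<r. \<phi> (\<alpha> x) l * ?T l x) = \<psi> (\<alpha> x) i" if "x \<in> W" for x
  proof -
    have x: "x \<in> U" "x \<in> V" using that W(2) by auto
    show ?thesis
      using linear_functional_expansion[OF \<phi> x(1) _ _ \<alpha>[OF that], of "\<lambda>e. \<psi> e i"]
        fibrewise_isoD(3,4)[OF \<psi> x(2)] by simp
  qed
  from W(1) this sum show ?thesis by (rule smooth_on_cong)
next
  case False
  have "\<psi> (\<alpha> x) i = 0" if "x \<in> W" for x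
  proof (rule fibrewise_iso_coord_0[OF \<psi>])
    show "x \<in> V" "\<alpha> x \<in> fibre A x" "s \<le> i" using that W(2) False \<alpha>[OF that] by auto
  qed
  then show ?thesis by (rule smooth_on_zero[OF W(1)])
qed

lemma atlas_local_trivialization: "(U, r, \<phi>) \<in> trivs A \<Longrightarrow> (U, r, \<phi>) \<in> local_trivializations M A"
  using triv trivs_compatible by (auto simp: local_trivializations_def)

lemma atlas_cover:
  obtains U r \<phi> where "(U, r, \<phi>) \<in> trivs A" "x \<in> U"
proof -
  have "x \<in> (\<Union>(U, r, \<phi>)\<in>trivs A. U)" using trivs_cover by simp
  then show ?thesis using that by auto
qed

lemma local_trivializationD:
  assumes "(U, r, \<phi>) \<in> local_trivializations M A"
  shows "open U" "fibrewise_iso A U r \<phi>"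
    "T \<in> trivs A \<Longrightarrow> smooth_transition M A (U, r, \<phi>) T"
    "T \<in> trivs A \<Longrightarrow> smooth_transition M A T (U, r, \<phi>)"
  using assms by (auto simp: local_trivializations_def)

text \<open>
  Local trivializations are compatible with the atlas by definition, and with one another because
  any change between two of them factors locally through a member of the atlas.
\<close>

lemma local_trivializations_compatible:
  assumes 1: "(U, r, \<phi>) \<in> local_trivializations M A" and 2: "(V, s, \<psi>) \<in> local_trivializations M A"
    and W: "open W" "W \<subseteq> U \<inter> V"
    and \<alpha>: "\<And>x. x \<in> W \<Longrightarrow> \<alpha> x \<in> fibre A x"
    and sm: "\<And>l. l < r \<Longrightarrow> smooth_on M W (\<lambda>x. \<phi> (\<alpha> x) l)"
  shows "smooth_on M W (\<lambda>x. \<psi> (\<alpha> x) i)"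
proof (rule smooth_on_locally[OF W(1)])
  fix x assume "x \<in> W"
  obtain U' r' \<xi> where t: "(U', r', \<xi>) \<in> trivs A" "x \<in> U'" by (rule atlas_cover)
  note T = local_trivializationD[OF 1] local_trivializationD[OF 2]
    local_trivializationD[OF atlas_local_trivialization[OF t(1)]]
  have W': "open (W \<inter> U')" "W \<inter> U' \<subseteq> W" using W(1) T(9) by auto
  have \<alpha>': "\<alpha> y \<in> fibre A y" if "y \<in> W \<inter> U'" for y using \<alpha> that by simp
  have sub: "W \<inter> U' \<subseteq> U \<inter> U'" "W \<inter> U' \<subseteq> U' \<inter> V" using W(2) by auto
  have "smooth_on M (W \<inter> U') (\<lambda>x. \<xi> (\<alpha> x) l)" for l
    using T(2,10) T(3)[OF t(1)] W'(1) sub(1) \<alpha>' smooth_on_subset[OF sm W'(2)]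
    by (rule smooth_coordinate_change)
  with T(10,6) T(8)[OF t(1)] W'(1) sub(2) \<alpha>'
  have "smooth_on M (W \<inter> U') (\<lambda>x. \<psi> (\<alpha> x) i)"
    by (rule smooth_coordinate_change)
  with T(9) t(2) show "\<exists>W'. open W' \<and> x \<in> W' \<and> smooth_on M (W \<inter> W') (\<lambda>x. \<psi> (\<alpha> x) i)"
    by (intro exI conjI)
qed

lemma sections_fibre: "\<alpha> \<in> sections M A \<Longrightarrow> \<alpha> x \<in> fibre A x"
  by (simp add: sections_def)

text \<open>
  The neighbourhood \<open>W\<close> may be smaller than the domain of the trivialization, as is needed for sections
  that are cut off by a bump function.
\<close>

definition smooth_section_near :: "('m \<Rightarrow> 'e) \<Rightarrow> 'm \<Rightarrow> bool" where
  "smooth_section_near \<alpha> x \<longleftrightarrow> (\<exists>U r \<phi> W. (U, r, \<phi>) \<in> local_trivializations M A \<and> open W \<and> x \<in> W \<and> W \<subseteq> U \<and>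
     (\<forall>l. smooth_on M W (\<lambda>x. \<phi> (\<alpha> x) l)))"

lemma smooth_section_nearI:
  assumes "(U, r, \<phi>) \<in> local_trivializations M A" "open W" "x \<in> W" "W \<subseteq> U"
    "\<And>l. smooth_on M W (\<lambda>x. \<phi> (\<alpha> x) l)"
  shows "smooth_section_near \<alpha> x"
  unfolding smooth_section_near_def
  by (intro exI conjI allI) (rule assms)+

text \<open>
  Smoothness of a section may be tested in one local trivialization near each point.
\<close>

lemma sectionsI:
  assumes \<alpha>: "\<And>x. \<alpha> x \<in> fibre A x" and loc: "\<And>x. smooth_section_near \<alpha> x"
  shows "\<alpha> \<in> sections M A"
  unfolding sections_def
proof (clarsimp simp: \<alpha>)
  fix V s \<psi> i assume V: "(V, s, \<psi>) \<in> trivs A"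
  show "smooth_on M V (\<lambda>x. \<psi> (\<alpha> x) i)"
  proof (rule smooth_on_locally)
    show op: "open V" using triv[OF V] by simp
    fix x assume "x \<in> V"
    from loc[of x] obtain U r \<phi> W
      where W: "(U, r, \<phi>) \<in> local_trivializations M A" "open W" "x \<in> W" "W \<subseteq> U"
        and sm: "\<forall>l. smooth_on M W (\<lambda>x. \<phi> (\<alpha> x) l)"
      unfolding smooth_section_near_def by (elim exE conjE) (rule that)
    have "smooth_on M (V \<inter> W) (\<lambda>x. \<psi> (\<alpha> x) i)"
    proof (rule local_trivializations_compatible[OF W(1) atlas_local_trivialization[OF V]])
      show "smooth_on M (V \<inter> W) (\<lambda>x. \<phi> (\<alpha> x) l)" for l
        using sm[rule_format, of l] by (rule smooth_on_subset) blast
      show "open (V \<inter> W)" "V \<inter> W \<subseteq> U \<inter> V" using op W(2,4) by auto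
    qed (rule \<alpha>)
    with W(2,3) show "\<exists>W. open W \<and> x \<in> W \<and> smooth_on M (V \<inter> W) (\<lambda>x. \<psi> (\<alpha> x) i)"
      by (intro exI conjI)
  qed
qed

lemma sections_coordinate_smooth:
  assumes "\<alpha> \<in> sections M A" "(V, s, \<psi>) \<in> local_trivializations M A"
  shows "smooth_on M V (\<lambda>x. \<psi> (\<alpha> x) i)"
proof (rule smooth_on_locally)
  show V: "open V" using local_trivializationD(1)[OF assms(2)] .
  fix x assume "x \<in> V"
  obtain U r \<phi> where t: "(U, r, \<phi>) \<in> trivs A" "x \<in> U" by (rule atlas_cover)
  have U: "open U" using triv[OF t(1)] by simp
  have "smooth_on M (V \<inter> U) (\<lambda>x. \<psi> (\<alpha> x) i)"
  proof (rule local_trivializations_compatible[OF atlas_local_trivialization[OF t(1)] assms(2)])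
    show "smooth_on M (V \<inter> U) (\<lambda>x. \<phi> (\<alpha> x) l)" if "l < r" for l
    proof (rule smooth_on_subset)
      show "smooth_on M U (\<lambda>x. \<phi> (\<alpha> x) l)" using assms(1) t(1) that by (auto simp: sections_def)
    qed simp
  qed (use V U sections_fibre[OF assms(1)] in auto)
  with U t(2) show "\<exists>W. open W \<and> x \<in> W \<and> smooth_on M (V \<inter> W) (\<lambda>x. \<psi> (\<alpha> x) i)"
    by (intro exI conjI)
qed

lemma sections_add:
  assumes "\<alpha> \<in> sections M A" "\<beta> \<in> sections M A"
  shows "sec_add A \<alpha> \<beta> \<in> sections M A"
proof (rule sectionsI)
  show "sec_add A \<alpha> \<beta> x \<in> fibre A x" for x
    using assms by (simp add: sec_add_def fib_add_closed sections_fibre)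
  fix x
  obtain U r \<phi> where t: "(U, r, \<phi>) \<in> trivs A" "x \<in> U" by (rule atlas_cover)
  note l = atlas_local_trivialization[OF t(1)]
  note T = local_trivializationD[OF l]
  have "smooth_on M U (\<lambda>x. \<phi> (sec_add A \<alpha> \<beta> x) i)" for i
    by (rule smooth_on_cong[OF T(1) _ smooth_on_add[OF T(1) sections_coordinate_smooth[OF assms(1) l, of i]
      sections_coordinate_smooth[OF assms(2) l, of i]]])
      (simp add: sec_add_def fibrewise_isoD(3)[OF T(2)] sections_fibre[OF assms(1)] sections_fibre[OF assms(2)])
  then show "smooth_section_near (sec_add A \<alpha> \<beta>) x"
    by (rule smooth_section_nearI[OF l T(1) t(2) order_refl])
qed

lemma sections_scale:
  assumes "f \<in> smooth_functions M" "\<alpha> \<in> sections M A"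
  shows "sec_scale A f \<alpha> \<in> sections M A"
proof (rule sectionsI)
  show "sec_scale A f \<alpha> x \<in> fibre A x" for x
    using assms by (simp add: sec_scale_def fib_scale_closed sections_fibre)
  fix x
  obtain U r \<phi> where t: "(U, r, \<phi>) \<in> trivs A" "x \<in> U" by (rule atlas_cover)
  note l = atlas_local_trivialization[OF t(1)]
  note T = local_trivializationD[OF l]
  have f: "smooth_on M U f" using assms(1) smooth_on_subset by (auto simp: smooth_functions_def)
  have "smooth_on M U (\<lambda>x. \<phi> (sec_scale A f \<alpha> x) i)" for i
    by (rule smooth_on_cong[OF T(1) _ smooth_on_mult[OF T(1) f sections_coordinate_smooth[OF assms(2) l, of i]]])
      (simp add: sec_scale_def fibrewise_isoD(4)[OF T(2)] sections_fibre[OF assms(2)])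
  then show "smooth_section_near (sec_scale A f \<alpha>) x"
    by (rule smooth_section_nearI[OF l T(1) t(2) order_refl])
qed

lemma sections_zero: "fib_zero A \<in> sections M A"
proof (rule sectionsI)
  fix x
  obtain U r \<phi> where t: "(U, r, \<phi>) \<in> trivs A" "x \<in> U" by (rule atlas_cover)
  note l = atlas_local_trivialization[OF t(1)]
  note T = local_trivializationD[OF l]
  have "smooth_on M U (\<lambda>x. \<phi> (fib_zero A x) i)" for i
    by (rule smooth_on_zero[OF T(1)]) (simp add: fibrewise_isoD(2)[OF T(2)])
  then show "smooth_section_near (fib_zero A) x"
    by (rule smooth_section_nearI[OF l T(1) t(2) order_refl])
qed (rule fib_zero_closed)

lemma adapted_trivD:
  assumes "(U, k, \<phi>) \<in> adapted_trivs M A B"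
  obtains r where "k \<le> r" "(U, r, \<phi>) \<in> local_trivializations M A"
    "\<And>x e. x \<in> U \<Longrightarrow> e \<in> fibre A x \<Longrightarrow> e \<in> B \<longleftrightarrow> \<phi> e \<in> cspace k"
  using assms by (auto simp: adapted_trivs_def)

lemma adapted_cover:
  assumes "is_subbundle M A B"
  obtains U k \<phi> where "(U, k, \<phi>) \<in> adapted_trivs M A B" "x \<in> U"
proof -
  have "x \<in> (\<Union>(U, k, \<phi>)\<in>adapted_trivs M A B. U)" using assms by (simp add: is_subbundle_def)
  then show ?thesis using that by auto
qed

lemma fibre_subbundle:
  "is_subbundle M A B \<Longrightarrow> fibre (subbundle M A B) x = fibre A x \<inter> B"
  by (auto simp: fibre_def subbundle_def is_subbundle_def)

text \<open>
  That \<open>B\<close> meets the fibres in linear subspaces is part of being straightened by linear maps to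
  \<open>cspace k\<close>.
\<close>

lemma subbundle_linear:
  assumes B: "is_subbundle M A B"
  shows "fib_zero A x \<in> B"
    and "\<lbrakk>a \<in> fibre A x; b \<in> fibre A x; a \<in> B; b \<in> B\<rbrakk> \<Longrightarrow> fib_add A a b \<in> B"
    and "\<lbrakk>a \<in> fibre A x; a \<in> B\<rbrakk> \<Longrightarrow> fib_scale A c a \<in> B"
proof -
  obtain U k \<phi> where "(U, k, \<phi>) \<in> adapted_trivs M A B" and x: "x \<in> U"
    using B by (rule adapted_cover)
  then obtain r where l: "(U, r, \<phi>) \<in> local_trivializations M A"
    and a: "\<And>e. e \<in> fibre A x \<Longrightarrow> e \<in> B \<longleftrightarrow> \<phi> e \<in> cspace k"
    using x by - (erule adapted_trivD, rule that, blast+)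
  note D = fibrewise_isoD[OF local_trivializationD(2)[OF l] x]
  show "fib_zero A x \<in> B" using a[OF fib_zero_closed] D(2) by (simp add: cspace_def)
  show "fib_add A a b \<in> B" if "a \<in> fibre A x" "b \<in> fibre A x" "a \<in> B" "b \<in> B" for a b
    using a[OF fib_add_closed] a D(3) that by (simp add: cspace_def)
  show "fib_scale A c a \<in> B" if "a \<in> fibre A x" "a \<in> B" for a c
    using a[OF fib_scale_closed] a D(4) that by (simp add: cspace_def)
qed

text \<open>
  In an adapted trivialization the coordinates of a section of \<open>B\<close> beyond the rank of \<open>B\<close> vanish, so
  testing smoothness in \<open>B\<close> and in \<open>A\<close> amounts to the same.
\<close>

lemma sections_subbundle:
  assumes B: "is_subbundle M A B"
  shows "sections M (subbundle M A B) = {\<alpha> \<in> sections M A. \<forall>x. \<alpha> x \<in> B}"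
proof (intro subset_antisym subsetI)
  fix \<alpha> assume \<alpha>: "\<alpha> \<in> sections M (subbundle M A B)"
  have fib: "\<alpha> x \<in> fibre A x" "\<alpha> x \<in> B" for x
    using \<alpha> by (auto simp: sections_def fibre_subbundle[OF B])
  have "\<alpha> \<in> sections M A"
  proof (rule sectionsI[OF fib(1)])
    fix x
    obtain U k \<phi> where t: "(U, k, \<phi>) \<in> adapted_trivs M A B" and x: "x \<in> U"
      using B by (rule adapted_cover)
    obtain r where "k \<le> r" and l: "(U, r, \<phi>) \<in> local_trivializations M A"
      and a: "\<And>x e. x \<in> U \<Longrightarrow> e \<in> fibre A x \<Longrightarrow> e \<in> B \<longleftrightarrow> \<phi> e \<in> cspace k"
      using t by (rule adapted_trivD) (rule that)
    note U = local_trivializationD(1)[OF l]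
    have "smooth_on M U (\<lambda>x. \<phi> (\<alpha> x) i)" for i
    proof (cases "i < k")
      case True
      then show ?thesis using \<alpha> t by (auto simp: sections_def subbundle_def)
    next
      case False
      then have "\<phi> (\<alpha> x) i = 0" if "x \<in> U" for x
        using a[OF that fib(1)] fib(2) by (simp add: cspace_def)
      then show ?thesis by (rule smooth_on_zero[OF U])
    qed
    then show "smooth_section_near \<alpha> x"
      by (rule smooth_section_nearI[OF l U x order_refl])
  qed
  then show "\<alpha> \<in> {\<alpha> \<in> sections M A. \<forall>x. \<alpha> x \<in> B}" using fib(2) by simp
next
  fix \<alpha> assume \<alpha>: "\<alpha> \<in> {\<alpha> \<in> sections M A. \<forall>x. \<alpha> x \<in> B}"
  have "smooth_on M U (\<lambda>x. \<phi> (\<alpha> x) i)" if t: "(U, k, \<phi>) \<in> adapted_trivs M A B" for U k \<phi> i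
  proof -
    obtain r where "(U, r, \<phi>) \<in> local_trivializations M A"
      using t by (rule adapted_trivD) (rule that)
    then show ?thesis using \<alpha> sections_coordinate_smooth by simp
  qed
  moreover have "\<alpha> x \<in> fibre (subbundle M A B) x" for x
    using \<alpha> sections_fibre by (simp add: fibre_subbundle[OF B])
  moreover have "trivs (subbundle M A B) = adapted_trivs M A B" by (simp add: subbundle_def)
  ultimately show "\<alpha> \<in> sections M (subbundle M A B)"
    unfolding sections_def by (simp add: split_def) (metis prod.collapse)
qed

text \<open>
  The adapted trivializations of \<open>A\<close>, with the rank lowered, form a bundle atlas of \<open>B\<close>; their
  transition functions are among the transition functions of local trivializations of \<open>A\<close>.
\<close>

lemma subbundle_complex_vector_bundle:
  assumes B: "is_subbundle M A B"
  shows "complex_vector_bundle M (subbundle M A B)"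
proof
  let ?S = "subbundle M A B"
  note fib = fibre_subbundle[OF B]
  have [simp]: "fib_zero ?S = fib_zero A" "fib_add ?S = fib_add A" "fib_scale ?S = fib_scale A"
    "trivs ?S = adapted_trivs M A B"
    by (simp_all add: subbundle_def)
  show "fib_zero ?S x \<in> fibre ?S x" for x
    using subbundle_linear(1)[OF B] fib_zero_closed by (simp add: fib)
  show "fib_add ?S a b \<in> fibre ?S x" if "a \<in> fibre ?S x" "b \<in> fibre ?S x" for a b x
    using subbundle_linear(2)[OF B, of a x b] fib_add_closed that by (simp add: fib)
  show "fib_scale ?S c a \<in> fibre ?S x" if "a \<in> fibre ?S x" for a x c
    using subbundle_linear(3)[OF B, of a x] fib_scale_closed that by (simp add: fib)
  show "(\<Union>(U, r, \<phi>)\<in>trivs ?S. U) = UNIV"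
    using B by (simp add: is_subbundle_def)
  show "open U \<and> fibrewise_iso ?S U k \<phi>" if t: "(U, k, \<phi>) \<in> trivs ?S" for U k \<phi>
  proof -
    obtain r where kr: "k \<le> r" and l: "(U, r, \<phi>) \<in> local_trivializations M A"
      and a: "\<And>x e. x \<in> U \<Longrightarrow> e \<in> fibre A x \<Longrightarrow> e \<in> B \<longleftrightarrow> \<phi> e \<in> cspace k"
      using t unfolding \<open>trivs ?S = _\<close> by (rule adapted_trivD) (rule that)
    note T = local_trivializationD[OF l]
    have "bij_betw \<phi> (fibre A x \<inter> B) (cspace k)" if x: "x \<in> U" for x
      unfolding bij_betw_def
    proof
      note bij = fibrewise_isoD(1)[OF T(2) x]
      show "inj_on \<phi> (fibre A x \<inter> B)" using bij by (auto simp: bij_betw_def inj_on_def)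
      show "\<phi> ` (fibre A x \<inter> B) = cspace k"
      proof
        show "\<phi> ` (fibre A x \<inter> B) \<subseteq> cspace k" using a[OF x] by auto
        show "cspace k \<subseteq> \<phi> ` (fibre A x \<inter> B)"
        proof
          fix z assume z: "z \<in> cspace k"
          note J = fibrewise_iso_inv[OF T(2) x cspace_mono[OF kr z]]
          show "z \<in> \<phi> ` (fibre A x \<inter> B)"
            using a[OF x J(1)] J z by (metis IntI image_eqI)
        qed
      qed
    qed
    then show ?thesis
      using T(1) fibrewise_isoD(2-4)[OF T(2)] by (auto simp: fibrewise_iso_def fib)
  qed
  show "smooth_transition M ?S T T'" if "T \<in> trivs ?S" "T' \<in> trivs ?S" for T T'
  proof -
    obtain U k \<phi> V k' \<psi> where eq: "T = (U, k, \<phi>)" "T' = (V, k', \<psi>)"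
      by (metis prod_cases3)
    have T: "(U, k, \<phi>) \<in> adapted_trivs M A B" and T': "(V, k', \<psi>) \<in> adapted_trivs M A B"
      using that by (simp_all add: eq)
    obtain r where kr: "k \<le> r" and l: "(U, r, \<phi>) \<in> local_trivializations M A"
      and a: "\<And>x e. x \<in> U \<Longrightarrow> e \<in> fibre A x \<Longrightarrow> e \<in> B \<longleftrightarrow> \<phi> e \<in> cspace k"
      using T by (rule adapted_trivD) (rule that)
    obtain s where "k' \<le> s" and l': "(V, s, \<psi>) \<in> local_trivializations M A"
      using T' by (rule adapted_trivD) (rule that)
    note U = local_trivializationD(1,2)[OF l] and V = local_trivializationD(1,2)[OF l']
    have "smooth_on M (U \<inter> V) (\<lambda>x. \<psi> (inv_into (fibre ?S x) \<phi> (cunit j)) i)" if "j < k" for i j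
    proof (rule smooth_on_cong)
      let ?\<alpha> = "\<lambda>x. inv_into (fibre A x) \<phi> (cunit j)"
      have cj: "cunit j \<in> cspace r" "cunit j \<in> cspace k" using that kr by (auto intro: cunit_cspace)
      note J = fibrewise_iso_inv[OF U(2) _ cj(1)]
      show op: "open (U \<inter> V)" using U(1) V(1) by (rule open_Int)
      show "smooth_on M (U \<inter> V) (\<lambda>x. \<psi> (?\<alpha> x) i)"
      proof (rule local_trivializations_compatible[OF l l' op])
        show "smooth_on M (U \<inter> V) (\<lambda>x. \<phi> (?\<alpha> x) m)" for m
          by (rule smooth_on_cong[OF op _ smooth_on_const[OF op, of "cunit j m"]]) (simp add: J(2))
      qed (use J(1) in auto)
      show "\<psi> (?\<alpha> x) i = \<psi> (inv_into (fibre ?S x) \<phi> (cunit j)) i" if x: "x \<in> U \<inter> V" for x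
      proof -
        have xU: "x \<in> U" using x by simp
        have inj: "inj_on \<phi> (fibre A x)" using fibrewise_isoD(1)[OF U(2) xU] by (simp add: bij_betw_def)
        have "?\<alpha> x \<in> fibre ?S x" using a[OF xU J(1)[OF xU]] J[OF xU] cj(2) by (simp add: fib)
        then have "inv_into (fibre ?S x) \<phi> (\<phi> (?\<alpha> x)) = ?\<alpha> x"
          by (rule inv_into_f_f[OF inj_on_subset[OF inj], rotated]) (auto simp: fib)
        then show ?thesis using J(2)[OF xU] by simp
      qed
    qed
    then show ?thesis by (simp add: eq smooth_transition_def)
  qed
qed

text \<open>
  Extend the vector with constant coordinates in an adapted trivialization and cut off by a bump
  function, normalized to the value \<open>1\<close> at \<open>x\<close>.
\<close>

lemma subbundle_section_through:
  assumes B: "is_subbundle M A B" and e: "e \<in> fibre A x" "e \<in> B"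
  obtains \<alpha> where "\<alpha> \<in> sections M A" "\<And>y. \<alpha> y \<in> B" "\<alpha> x = e"
proof -
  obtain U k \<phi> where t: "(U, k, \<phi>) \<in> adapted_trivs M A B" and x: "x \<in> U"
    using B by (rule adapted_cover)
  obtain r where kr: "k \<le> r" and l: "(U, r, \<phi>) \<in> local_trivializations M A"
    and a: "\<And>x e. x \<in> U \<Longrightarrow> e \<in> fibre A x \<Longrightarrow> e \<in> B \<longleftrightarrow> \<phi> e \<in> cspace k"
    using t by (rule adapted_trivD) (rule that)
  note T = local_trivializationD(1,2)[OF l]
  obtain h :: "'m \<Rightarrow> real" and K where h: "smooth_on M UNIV h" "h x \<noteq> 0"
    and K: "closed K" "K \<subseteq> U" "\<And>y. y \<notin> K \<Longrightarrow> h y = 0"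
    using bump_function[OF T(1) x] by metis
  \<comment> \<open>The coordinates of the section: those of \<open>e\<close> at \<open>x\<close>, and zero outside \<open>K\<close>.\<close>
  define z where "z = (\<lambda>y i. complex_of_real (h y / h x) * \<phi> e i)"
  define \<alpha> where "\<alpha> = (\<lambda>y. if y \<in> U then inv_into (fibre A y) \<phi> (z y) else fib_zero A y)"
  have zk: "z y \<in> cspace k" for y using a[OF x e(1)] e(2) by (auto simp: z_def cspace_def)
  then have zr: "z y \<in> cspace r" for y using kr cspace_mono by blast
  have J: "inv_into (fibre A y) \<phi> (z y) \<in> fibre A y" "\<phi> (inv_into (fibre A y) \<phi> (z y)) = z y"
    if "y \<in> U" for y using fibrewise_iso_inv[OF T(2) that zr] by auto
  have fib: "\<alpha> y \<in> fibre A y" for y using J fib_zero_closed by (simp add: \<alpha>_def)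
  have "\<alpha> y \<in> B" for y
    using J a[OF _ J(1)] zk subbundle_linear(1)[OF B] by (simp add: \<alpha>_def)
  moreover have "\<alpha> x = e"
  proof (rule fibrewise_iso_eqI[OF T(2) x fib e(1)])
    have "\<phi> (\<alpha> x) = z x" using J(2)[OF x] x by (simp add: \<alpha>_def)
    then show "\<phi> (\<alpha> x) = \<phi> e" using h(2) by (simp add: z_def)
  qed
  moreover have "\<alpha> \<in> sections M A"
  proof (rule sectionsI[OF fib])
    fix y
    show "smooth_section_near \<alpha> y"
    proof (cases "y \<in> U")
      case True
      have "smooth_on M U (\<lambda>y. \<phi> (\<alpha> y) i)" for i
      proof (rule smooth_on_cong[OF T(1)])
        show "smooth_on M U (\<lambda>y. complex_of_real (h y) * (\<phi> e i / complex_of_real (h x)))"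
          by (intro smooth_on_mult smooth_on_const T(1) smooth_on_bounded_linear[OF _ bounded_linear_of_real]
            smooth_on_subset[OF h(1)]) simp
        show "complex_of_real (h y) * (\<phi> e i / complex_of_real (h x)) = \<phi> (\<alpha> y) i" if "y \<in> U" for y
        proof -
          have "\<phi> (\<alpha> y) = z y" using J(2)[OF that] that by (simp add: \<alpha>_def)
          then show ?thesis by (simp add: z_def)
        qed
      qed
      then show ?thesis by (rule smooth_section_nearI[OF l T(1) True order_refl])
    next
      case False
      obtain V s \<psi> where V: "(V, s, \<psi>) \<in> trivs A" "y \<in> V" by (rule atlas_cover)
      note l' = atlas_local_trivialization[OF V(1)]
      note T' = local_trivializationD(1,2)[OF l']
      have op: "open (V \<inter> - K)" using T'(1) K(1) by auto
      have "\<alpha> y' = fib_zero A y'" if "y' \<notin> K" for y'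
      proof (cases "y' \<in> U")
        case True
        show ?thesis
        proof (rule fibrewise_iso_eqI[OF T(2) True fib fib_zero_closed])
          have "\<phi> (\<alpha> y') = z y'" using J(2)[OF True] True by (simp add: \<alpha>_def)
          then show "\<phi> (\<alpha> y') = \<phi> (fib_zero A y')"
            using K(3)[OF that] fibrewise_isoD(2)[OF T(2) True] by (simp add: z_def)
        qed
      qed (simp add: \<alpha>_def)
      then have "smooth_on M (V \<inter> - K) (\<lambda>y. \<psi> (\<alpha> y) i)" for i
        by (intro smooth_on_zero[OF op]) (simp add: fibrewise_isoD(2)[OF T'(2)])
      moreover have "y \<in> V \<inter> - K" using V(2) False K(2) by blast
      ultimately show ?thesis by (intro smooth_section_nearI[OF l' op]) auto
    qed
  qed
  ultimately show thesis using that by blast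
qed

end

section \<open>Complex vector fields and conjugation\<close>

context smooth_manifold
begin

lemma smooth_functions_const: "(\<lambda>x. c) \<in> smooth_functions M"
  by (simp add: smooth_functions_def smooth_on_const)

lemma smooth_functions_mult:
  fixes f g :: "'m \<Rightarrow> 'a::real_normed_algebra"
  shows "f \<in> smooth_functions M \<Longrightarrow> g \<in> smooth_functions M \<Longrightarrow> (\<lambda>x. f x * g x) \<in> smooth_functions M"
  by (simp add: smooth_functions_def smooth_on_mult)

lemma smooth_functions_linear:
  assumes "bounded_linear L" "f \<in> smooth_functions M"
  shows "(\<lambda>x. L (f x)) \<in> smooth_functions M"
  using smooth_on_bounded_linear[OF open_UNIV assms(1)] assms(2) by (simp add: smooth_functions_def)

lemmas smooth_functions_Re = smooth_functions_linear[OF bounded_linear_Re]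
lemmas smooth_functions_Im = smooth_functions_linear[OF bounded_linear_Im]
lemmas smooth_functions_cnj = smooth_functions_linear[OF bounded_linear_cnj]
lemmas smooth_functions_of_real = smooth_functions_linear[OF bounded_linear_of_real]
lemmas smooth_functions_uminus = smooth_functions_linear[OF bounded_linear_minus[OF bounded_linear_ident]]

lemma tangent_spaceD:
  assumes "v \<in> tangent_space M x"
  shows "f \<notin> smooth_functions M \<Longrightarrow> v f = 0"
    and "f \<in> smooth_functions M \<Longrightarrow> g \<in> smooth_functions M \<Longrightarrow> v (\<lambda>y. f y + g y) = v f + v g"
    and "f \<in> smooth_functions M \<Longrightarrow> v (\<lambda>y. c * f y) = c * v f"
    and "f \<in> smooth_functions M \<Longrightarrow> g \<in> smooth_functions M \<Longrightarrow>
      v (\<lambda>y. f y * g y) = f x * v g + v f * g x"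
  using assms unfolding tangent_space_def by simp_all

lemma tangent_zero: "v \<in> tangent_space M x \<Longrightarrow> v (\<lambda>y. 0) = 0"
  using tangent_spaceD(3)[of v x "\<lambda>y. 0" 0] by (simp add: smooth_functions_const)

lemma tangent_uminus:
  "v \<in> tangent_space M x \<Longrightarrow> f \<in> smooth_functions M \<Longrightarrow> v (\<lambda>y. - f y) = - v f"
  using tangent_spaceD(3)[of v x f "-1"] by simp

lemma tangent_diff:
  assumes "v \<in> tangent_space M x" "f \<in> smooth_functions M" "g \<in> smooth_functions M"
  shows "v (\<lambda>y. f y - g y) = v f - v g"
  using tangent_spaceD(2)[OF assms(1,2) smooth_functions_uminus[OF assms(3)]] tangent_uminus[OF assms(1,3)]
  by simp

lemma ctangent_spaceD:
  "Z \<in> ctangent_space M x \<Longrightarrow> fst Z \<in> tangent_space M x"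
  "Z \<in> ctangent_space M x \<Longrightarrow> snd Z \<in> tangent_space M x"
  by (auto simp: ctangent_space_def)

text \<open>
  The Leibniz rule for derivations of real functions extends to complex functions by bilinearity.
\<close>

lemma ctangent_apply_mult:
  assumes Z: "Z \<in> ctangent_space M x" and f: "f \<in> smooth_functions M" and g: "g \<in> smooth_functions M"
  shows "ctangent_apply Z (\<lambda>y. f y * g y) = f x * ctangent_apply Z g + ctangent_apply Z f * g x"
proof -
  note Z = ctangent_spaceD[OF Z]
  note s = smooth_functions_Re[OF f] smooth_functions_Im[OF f] smooth_functions_Re[OF g] smooth_functions_Im[OF g]
  have *: "v (\<lambda>y. Re (f y) * Re (g y) - Im (f y) * Im (g y)) =
      Re (f x) * v (\<lambda>y. Re (g y)) + v (\<lambda>y. Re (f y)) * Re (g x)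
      - (Im (f x) * v (\<lambda>y. Im (g y)) + v (\<lambda>y. Im (f y)) * Im (g x)) \<and>
      v (\<lambda>y. Re (f y) * Im (g y) + Im (f y) * Re (g y)) =
      Re (f x) * v (\<lambda>y. Im (g y)) + v (\<lambda>y. Re (f y)) * Im (g x)
      + (Im (f x) * v (\<lambda>y. Re (g y)) + v (\<lambda>y. Im (f y)) * Re (g x))"
    if v: "v \<in> tangent_space M x" for v
    by (simp add: tangent_diff[OF v] tangent_spaceD(2,4)[OF v] smooth_functions_mult s)
  from *[OF Z(1)] *[OF Z(2)] show ?thesis
    by (simp add: ctangent_apply_def complex_eq_iff algebra_simps)
qed

lemma ctangent_eqI:
  assumes Z: "Z \<in> ctangent_space M x" "Z' \<in> ctangent_space M x"
    and eq: "\<And>f. f \<in> smooth_functions M \<Longrightarrow>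
      ctangent_apply Z (\<lambda>y. complex_of_real (f y)) = ctangent_apply Z' (\<lambda>y. complex_of_real (f y))"
  shows "Z = Z'"
proof -
  note T = ctangent_spaceD[OF Z(1)] ctangent_spaceD[OF Z(2)]
  note z = T[THEN tangent_zero] and n = T[THEN tangent_spaceD(1)]
  have "fst Z f = fst Z' f \<and> snd Z f = snd Z' f" for f
  proof (cases "f \<in> smooth_functions M")
    case True
    then show ?thesis using eq[OF True] by (simp add: ctangent_apply_def z)
  next
    case False
    then show ?thesis by (simp add: n)
  qed
  then show ?thesis by (auto simp: prod_eq_iff)
qed

end

definition ctangent_cnj :: "'m ctangent \<Rightarrow> 'm ctangent" where
  "ctangent_cnj Z = (fst Z, \<lambda>f. - snd Z f)"

lemma ctangent_apply_add: "ctangent_apply (ctangent_add X Y) f = ctangent_apply X f + ctangent_apply Y f"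
  by (simp add: ctangent_apply_def ctangent_add_def complex_eq_iff)

lemma ctangent_apply_scale: "ctangent_apply (ctangent_scale c X) f = c * ctangent_apply X f"
  by (simp add: ctangent_apply_def ctangent_scale_def complex_eq_iff algebra_simps)

context smooth_manifold
begin

lemma ctangent_cnj_closed:
  assumes "Z \<in> ctangent_space M x" shows "ctangent_cnj Z \<in> ctangent_space M x"
proof -
  have "(\<lambda>f. - v f) \<in> tangent_space M x" if "v \<in> tangent_space M x" for v
    using that unfolding tangent_space_def by (simp add: algebra_simps)
  then show ?thesis using assms by (auto simp: ctangent_cnj_def ctangent_space_def)
qed

lemma ctangent_apply_cnj:
  assumes "Z \<in> ctangent_space M x" "f \<in> smooth_functions M"
  shows "ctangent_apply (ctangent_cnj Z) f = cnj (ctangent_apply Z (\<lambda>y. cnj (f y)))"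
  using ctangent_spaceD[OF assms(1), THEN tangent_uminus, OF smooth_functions_Im[OF assms(2)]]
  by (simp add: ctangent_apply_def ctangent_cnj_def complex_eq_iff)

lemma vf_apply_smooth:
  "X \<in> smooth_cvector_fields M \<Longrightarrow> f \<in> smooth_functions M \<Longrightarrow> vf_apply X f \<in> smooth_functions M"
  by (simp add: smooth_cvector_fields_def)

lemma vf_apply_zero:
  assumes "X \<in> smooth_cvector_fields M" shows "vf_apply X (\<lambda>y. 0) = (\<lambda>y. 0)"
proof
  fix x
  have "X x \<in> ctangent_space M x" using assms by (simp add: smooth_cvector_fields_def)
  from ctangent_spaceD[OF this, THEN tangent_zero] show "vf_apply X (\<lambda>y. 0) x = 0"
    by (simp add: vf_apply_def ctangent_apply_def complex_eq_iff)
qed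

text \<open>
  The definition records the commutator on real functions by its real and imaginary parts; the
  complex-linear extension reassembles them, the imaginary part of the argument being \<open>0\<close>.
\<close>

lemma vf_bracket_apply:
  assumes "X \<in> smooth_cvector_fields M" "Y \<in> smooth_cvector_fields M" "f \<in> smooth_functions M"
  shows "ctangent_apply (vf_bracket M X Y x) (\<lambda>y. complex_of_real (f y)) =
    vf_apply X (vf_apply Y (\<lambda>y. complex_of_real (f y))) x
    - vf_apply Y (vf_apply X (\<lambda>y. complex_of_real (f y))) x"
proof -
  define D where "D = (\<lambda>f. if f \<in> smooth_functions M
      then vf_apply X (vf_apply Y (\<lambda>y. complex_of_real (f y))) x
        - vf_apply Y (vf_apply X (\<lambda>y. complex_of_real (f y))) x else 0)"
  have "vf_bracket M X Y x = (\<lambda>f. Re (D f), \<lambda>f. Im (D f))"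
    unfolding vf_bracket_def D_def Let_def by (rule refl)
  moreover have "D (\<lambda>y. 0) = 0"
    by (simp add: D_def vf_apply_zero[OF assms(1)] vf_apply_zero[OF assms(2)])
  ultimately have "ctangent_apply (vf_bracket M X Y x) (\<lambda>y. complex_of_real (f y)) = D f"
    by (simp only: ctangent_apply_def fst_conv snd_conv Re_complex_of_real Im_complex_of_real)
      (simp add: complex_eq_iff)
  then show ?thesis using assms(3) by (simp add: D_def)
qed

lemma vf_apply_mult:
  assumes "X \<in> smooth_cvector_fields M" "f \<in> smooth_functions M" "g \<in> smooth_functions M"
  shows "vf_apply X (\<lambda>y. f y * g y) x = f x * vf_apply X g x + vf_apply X f x * g x"
  using ctangent_apply_mult[of "X x" x f g] assms by (simp add: vf_apply_def smooth_cvector_fields_def)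

lemma vf_cnj_apply:
  assumes "X \<in> smooth_cvector_fields M" "f \<in> smooth_functions M"
  shows "vf_apply (\<lambda>x. ctangent_cnj (X x)) f x = cnj (vf_apply X (\<lambda>y. cnj (f y)) x)"
  using ctangent_apply_cnj[of "X x" x f] assms by (simp add: vf_apply_def smooth_cvector_fields_def)

lemma vf_cnj_closed:
  assumes "X \<in> smooth_cvector_fields M"
  shows "(\<lambda>x. ctangent_cnj (X x)) \<in> smooth_cvector_fields M"
proof -
  have "vf_apply (\<lambda>x. ctangent_cnj (X x)) f \<in> smooth_functions M" if f: "f \<in> smooth_functions M" for f
  proof -
    have "vf_apply (\<lambda>x. ctangent_cnj (X x)) f = (\<lambda>x. cnj (vf_apply X (\<lambda>y. cnj (f y)) x))"
      using vf_cnj_apply[OF assms f] by (rule ext)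
    moreover have "(\<lambda>x. cnj (vf_apply X (\<lambda>y. cnj (f y)) x)) \<in> smooth_functions M"
      by (rule smooth_functions_cnj[OF vf_apply_smooth[OF assms smooth_functions_cnj[OF f]]])
    ultimately show ?thesis by simp
  qed
  then show ?thesis
    using assms ctangent_cnj_closed by (simp add: smooth_cvector_fields_def)
qed

lemma vf_bracket_zero:
  assumes "X \<in> smooth_cvector_fields M" "Y \<in> smooth_cvector_fields M"
  shows "fst (vf_bracket M X Y x) (\<lambda>y. 0) = 0" "snd (vf_bracket M X Y x) (\<lambda>y. 0) = 0"
  by (simp_all add: vf_bracket_def Let_def vf_apply_zero[OF assms(1)] vf_apply_zero[OF assms(2)])

text \<open>
  With \<open>Xc\<close>, \<open>Yc\<close> the conjugates of \<open>X\<close>, \<open>Y\<close>, this is the Leibniz rule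
  \<open>[G Xc, G Yc] = G\<^sup>2 [Xc, Yc] + (Xc G) (G Yc) - (Yc G) (G Xc)\<close>, solved for \<open>[Xc, Yc]\<close>, which is the
  conjugate of \<open>[X, Y]\<close>. The correction terms are again multiples of the given scaled fields.
\<close>

lemma vf_bracket_scaled_cnj:
  assumes X: "X \<in> smooth_cvector_fields M" and Y: "Y \<in> smooth_cvector_fields M"
    and X': "X' \<in> smooth_cvector_fields M" and Y': "Y' \<in> smooth_cvector_fields M"
    and G: "G \<in> smooth_functions M" and f: "f \<in> smooth_functions M"
    and eqX: "\<And>x. X' x = ctangent_scale (G x) (ctangent_cnj (X x))"
    and eqY: "\<And>x. Y' x = ctangent_scale (G x) (ctangent_cnj (Y x))"
  defines "F \<equiv> \<lambda>y. complex_of_real (f y)"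
  shows "(G x)\<^sup>2 * ctangent_apply (ctangent_cnj (vf_bracket M X Y x)) F =
    ctangent_apply (vf_bracket M X' Y' x) F
    - vf_apply (\<lambda>x. ctangent_cnj (X x)) G x * vf_apply Y' F x
    + vf_apply (\<lambda>x. ctangent_cnj (Y x)) G x * vf_apply X' F x"
proof -
  let ?X = "\<lambda>x. ctangent_cnj (X x)" and ?Y = "\<lambda>x. ctangent_cnj (Y x)"
  note cX = vf_cnj_closed[OF X] and cY = vf_cnj_closed[OF Y]
  have F: "F \<in> smooth_functions M" unfolding F_def by (rule smooth_functions_of_real[OF f])
  have F': "(\<lambda>y. cnj (F y)) = F" by (simp add: F_def)
  have cnj_cnj: "vf_apply (\<lambda>x. ctangent_cnj (U x)) (vf_apply (\<lambda>x. ctangent_cnj (V x)) F) x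
      = cnj (vf_apply U (vf_apply V F) x)"
    if U: "U \<in> smooth_cvector_fields M" and V: "V \<in> smooth_cvector_fields M" for U V :: "'m \<Rightarrow> 'm ctangent"
    using vf_cnj_apply[OF U vf_apply_smooth[OF vf_cnj_closed[OF V] F]]
    by (simp add: vf_cnj_apply[OF V F] F')
  have "ctangent_apply (ctangent_cnj (vf_bracket M X Y x)) F = cnj (ctangent_apply (vf_bracket M X Y x) F)"
    by (simp add: ctangent_apply_def ctangent_cnj_def F_def complex_eq_iff vf_bracket_zero[OF X Y])
  also have "\<dots> = vf_apply ?X (vf_apply ?Y F) x - vf_apply ?Y (vf_apply ?X F) x"
    using vf_bracket_apply[OF X Y f, of x] by (simp add: cnj_cnj X Y flip: F_def)
  finally have 1: "ctangent_apply (ctangent_cnj (vf_bracket M X Y x)) F =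
    vf_apply ?X (vf_apply ?Y F) x - vf_apply ?Y (vf_apply ?X F) x" .
  have sX: "vf_apply X' h y = G y * vf_apply ?X h y" and sY: "vf_apply Y' h y = G y * vf_apply ?Y h y" for h y
    by (simp_all add: vf_apply_def eqX eqY ctangent_apply_scale)
  have sX': "vf_apply X' h = (\<lambda>y. G y * vf_apply ?X h y)" and sY': "vf_apply Y' h = (\<lambda>y. G y * vf_apply ?Y h y)" for h
    by (auto simp: sX sY)
  have "ctangent_apply (vf_bracket M X' Y' x) F
      = G x * vf_apply ?X (\<lambda>y. G y * vf_apply ?Y F y) x - G x * vf_apply ?Y (\<lambda>y. G y * vf_apply ?X F y) x"
    using vf_bracket_apply[OF X' Y' f, of x] by (simp add: sX' sY' flip: F_def)
  also have "\<dots> = (G x)\<^sup>2 * (vf_apply ?X (vf_apply ?Y F) x - vf_apply ?Y (vf_apply ?X F) x)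
      + vf_apply ?X G x * vf_apply Y' F x - vf_apply ?Y G x * vf_apply X' F x"
    by (simp add: vf_apply_mult[OF cX G vf_apply_smooth[OF cY F]] vf_apply_mult[OF cY G vf_apply_smooth[OF cX F]]
        sX sY algebra_simps power2_eq_square)
  finally show ?thesis by (simp add: 1)
qed

end

section \<open>The real part and its complex span\<close>

context complex_lie_algebroid
begin

lemma fibre_eqI:
  assumes "a \<in> fibre A x" "b \<in> fibre A x"
    "\<And>U r \<phi> i. fibrewise_iso A U r \<phi> \<Longrightarrow> x \<in> U \<Longrightarrow> \<phi> a i = \<phi> b i"
  shows "a = b"
proof -
  obtain U r \<phi> where t: "(U, r, \<phi>) \<in> trivs A" and x: "x \<in> U" by (rule atlas_cover)
  have \<phi>: "fibrewise_iso A U r \<phi>" using triv[OF t] by simp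
  show ?thesis
    by (rule fibrewise_iso_eqI[OF \<phi> x assms(1,2)]) (rule ext, rule assms(3)[OF \<phi> x])
qed

lemma fib_scale_zero: "fib_scale A c (fib_zero A x) = fib_zero A x"
  by (rule fibre_eqI[where x = x]) (simp_all add: fib_scale_closed fib_zero_closed fibrewise_isoD(2,4))

lemma anchor_zero: "\<rho> (fib_zero A x) = (\<lambda>f. 0, \<lambda>f. 0)"
proof -
  have "\<rho> (fib_zero A x) = ctangent_scale 0 (\<rho> (fib_zero A x))"
    using anchor_scale[OF fib_zero_closed, of 0 x] by (simp add: fib_scale_zero)
  also have "\<dots> = (\<lambda>f. 0, \<lambda>f. 0)" by (simp add: ctangent_scale_def)
  finally show ?thesis .
qed

lemma re_part_subset_min_part: "re_part A \<rho> \<subseteq> min_part A \<rho>"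
proof
  fix a assume a: "a \<in> re_part A \<rho>"
  let ?x = "bproj A a" and ?z = "fib_zero A (bproj A a)"
  have fa: "a \<in> fibre A ?x" using a by (simp add: re_part_def fibre_def)
  have "snd (\<rho> ?z) = (\<lambda>f. 0)" by (simp add: anchor_zero)
  then have "?z \<in> re_part A \<rho>" "bproj A ?z = ?x"
    using fib_zero_closed[of ?x] by (simp_all add: re_part_def fibre_def)
  moreover have "a = fib_add A a (fib_scale A \<i> ?z)"
    by (rule fibre_eqI[where x = ?x])
      (simp_all add: fib_scale_zero fa fib_add_closed fib_zero_closed fibrewise_isoD(2,3))
  ultimately show "a \<in> min_part A \<rho>" using a unfolding min_part_def by force
qed

text \<open>
  If \<open>e = a + i b\<close> with real \<open>\<rho> a\<close> and \<open>\<rho> b\<close>, then \<open>a - i b\<close> has conjugate anchor. If \<open>e'\<close> has conjugate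
  anchor, then \<open>(e + e')/2\<close> and \<open>(e - e')/(2 i)\<close> have real anchor and combine to \<open>e\<close>.
\<close>

lemma min_part_iff:
  assumes e: "e \<in> fibre A x"
  shows "e \<in> min_part A \<rho> \<longleftrightarrow> (\<exists>e'\<in>fibre A x. \<rho> e' = ctangent_cnj (\<rho> e))"
proof
  assume "e \<in> min_part A \<rho>"
  then obtain a b where eq: "e = fib_add A a (fib_scale A \<i> b)" and ab: "a \<in> re_part A \<rho>" "b \<in> re_part A \<rho>"
    and bp: "bproj A a = bproj A b"
    by (auto simp: min_part_def)
  have "a \<in> fibre A (bproj A a)" "b \<in> fibre A (bproj A a)"
    using ab bp by (simp_all add: re_part_def fibre_def)
  moreover from this have "e \<in> fibre A (bproj A a)" by (simp add: eq fib_add_closed fib_scale_closed)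
  then have "bproj A a = x" using e by (simp add: fibre_def)
  ultimately have f: "a \<in> fibre A x" "b \<in> fibre A x" by simp_all
  have "snd (\<rho> a) = (\<lambda>f. 0)" "snd (\<rho> b) = (\<lambda>f. 0)" using ab by (simp_all add: re_part_def)
  then have "\<rho> (fib_add A a (fib_scale A (- \<i>) b)) = ctangent_cnj (\<rho> e)"
    by (simp add: eq anchor_add[OF f(1) fib_scale_closed[OF f(2)]] anchor_scale[OF f(2)]
        ctangent_add_def ctangent_scale_def ctangent_cnj_def)
  then show "\<exists>e'\<in>fibre A x. \<rho> e' = ctangent_cnj (\<rho> e)"
    using f fib_add_closed fib_scale_closed by blast
next
  assume "\<exists>e'\<in>fibre A x. \<rho> e' = ctangent_cnj (\<rho> e)"
  then obtain e' where e': "e' \<in> fibre A x" "\<rho> e' = ctangent_cnj (\<rho> e)" by blast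
  define a where "a = fib_scale A (1/2) (fib_add A e e')"
  define b where "b = fib_scale A (- \<i>/2) (fib_add A e (fib_scale A (-1) e'))"
  note cl = fib_add_closed fib_scale_closed
  have f: "a \<in> fibre A x" "b \<in> fibre A x" using e e'(1) by (simp_all add: a_def b_def cl)
  have "e = fib_add A a (fib_scale A \<i> b)"
  proof (rule fibre_eqI[OF e])
    fix U r \<phi> i assume \<phi>: "fibrewise_iso A U r \<phi>" "x \<in> U"
    show "\<phi> e i = \<phi> (fib_add A a (fib_scale A \<i> b)) i"
      using e e'(1) by (simp add: a_def b_def cl fibrewise_isoD(3,4)[OF \<phi>] algebra_simps)
  qed (use f in \<open>simp add: cl\<close>)
  moreover have "snd (\<rho> a) = (\<lambda>f. 0)"
    by (simp add: a_def anchor_scale[OF fib_add_closed[OF e e'(1)]] anchor_add[OF e e'(1)] e'(2)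
        ctangent_add_def ctangent_scale_def ctangent_cnj_def)
  moreover have "snd (\<rho> b) = (\<lambda>f. 0)"
    by (simp add: b_def anchor_scale[OF fib_add_closed[OF e fib_scale_closed[OF e'(1)]]]
        anchor_add[OF e fib_scale_closed[OF e'(1)]] anchor_scale[OF e'(1)] e'(2)
        ctangent_add_def ctangent_scale_def ctangent_cnj_def)
  ultimately have "e = fib_add A a (fib_scale A \<i> b)" "a \<in> re_part A \<rho>" "b \<in> re_part A \<rho>"
    "bproj A a = bproj A b"
    using f by (simp_all add: re_part_def fibre_def)
  then show "e \<in> min_part A \<rho>" unfolding min_part_def by blast
qed

section \<open>Lifting vector fields through the anchor at generic points\<close>

abbreviation sections_in :: "'e set \<Rightarrow> ('m \<Rightarrow> 'e) set" where
  "sections_in B \<equiv> {\<alpha> \<in> sections M A. \<forall>x. \<alpha> x \<in> B}"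

definition anchor_deriv :: "('m \<Rightarrow> 'e) \<Rightarrow> ('m \<Rightarrow> complex) \<Rightarrow> 'm \<Rightarrow> complex" where
  "anchor_deriv \<alpha> f = vf_apply (\<lambda>x. \<rho> (\<alpha> x)) f"

lemma anchor_deriv_smooth:
  "\<alpha> \<in> sections M A \<Longrightarrow> f \<in> smooth_functions M \<Longrightarrow> anchor_deriv \<alpha> f \<in> smooth_functions M"
  unfolding anchor_deriv_def by (rule vf_apply_smooth[OF anchor_smooth])

lemma anchor_deriv_add:
  assumes "\<alpha> \<in> sections M A" "\<beta> \<in> sections M A"
  shows "anchor_deriv (sec_add A \<alpha> \<beta>) f x = anchor_deriv \<alpha> f x + anchor_deriv \<beta> f x"
  by (simp add: anchor_deriv_def vf_apply_def sec_add_def ctangent_apply_add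
      anchor_add[OF sections_fibre[OF assms(1)] sections_fibre[OF assms(2)]])

lemma anchor_deriv_scale:
  assumes "\<alpha> \<in> sections M A"
  shows "anchor_deriv (sec_scale A c \<alpha>) f x = c x * anchor_deriv \<alpha> f x"
  by (simp add: anchor_deriv_def vf_apply_def sec_scale_def ctangent_apply_scale
      anchor_scale[OF sections_fibre[OF assms]])

lemma sections_in_add:
  assumes "is_subbundle M A B" "\<alpha> \<in> sections_in B" "\<beta> \<in> sections_in B"
  shows "sec_add A \<alpha> \<beta> \<in> sections_in B"
  using assms sections_add subbundle_linear(2)[OF assms(1) sections_fibre sections_fibre, of \<alpha> \<beta>]
  by (simp add: sec_add_def)

lemma sections_in_scale:
  assumes "is_subbundle M A B" "c \<in> smooth_functions M" "\<alpha> \<in> sections_in B"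
  shows "sec_scale A c \<alpha> \<in> sections_in B"
  using assms sections_scale subbundle_linear(3)[OF assms(1) sections_fibre, of \<alpha>]
  by (simp add: sec_scale_def)

primrec lincomb :: "nat \<Rightarrow> (nat \<Rightarrow> 'm \<Rightarrow> complex) \<Rightarrow> (nat \<Rightarrow> 'm \<Rightarrow> 'e) \<Rightarrow> 'm \<Rightarrow> 'e" where
  "lincomb 0 c e = fib_zero A"
| "lincomb (Suc r) c e = sec_add A (lincomb r c e) (sec_scale A (c r) (e r))"

lemma lincomb_closed:
  assumes "is_subbundle M A B" "\<And>i. i < r \<Longrightarrow> c i \<in> smooth_functions M" "\<And>i. i < r \<Longrightarrow> e i \<in> sections_in B"
  shows "lincomb r c e \<in> sections_in B"
  using assms(2,3)
proof (induction r)
  case 0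
  then show ?case using sections_zero subbundle_linear(1)[OF assms(1)] by simp
next
  case (Suc r)
  show ?case
    unfolding lincomb.simps
    using Suc by (intro sections_in_add[OF assms(1)] sections_in_scale[OF assms(1)]) simp_all
qed

lemma anchor_deriv_lincomb:
  assumes "is_subbundle M A B" "\<And>i. i < r \<Longrightarrow> c i \<in> smooth_functions M" "\<And>i. i < r \<Longrightarrow> e i \<in> sections_in B"
  shows "anchor_deriv (lincomb r c e) f x = (\<Sum>i<r. c i x * anchor_deriv (e i) f x)"
  using assms(2,3)
proof (induction r)
  case 0
  then show ?case
    by (simp add: anchor_deriv_def vf_apply_def anchor_zero ctangent_apply_def complex_eq_iff)
next
  case (Suc r)
  have "lincomb r c e \<in> sections M A" "e r \<in> sections M A" "c r \<in> smooth_functions M"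
    using lincomb_closed[OF assms(1), of r c e] Suc.prems by auto
  then show ?case
    using Suc by (simp add: anchor_deriv_add anchor_deriv_scale sections_scale)
qed

text \<open>
  Up to the common factor \<open>g\<close>, the anchors of the sections \<open>e i\<close> are dual to the functions \<open>f j\<close>; in
  particular they are linearly independent wherever \<open>g\<close> is nonzero. Keeping \<open>g\<close> instead of dividing by
  it lets all the identities hold on the whole manifold with global sections and functions.
\<close>

definition dual_system ::
  "'e set \<Rightarrow> nat \<Rightarrow> ('m \<Rightarrow> complex) \<Rightarrow> (nat \<Rightarrow> 'm \<Rightarrow> 'e) \<Rightarrow> (nat \<Rightarrow> 'm \<Rightarrow> complex) \<Rightarrow> bool" where
  "dual_system B r g e f \<longleftrightarrow> g \<in> smooth_functions M \<and>
     (\<forall>i<r. e i \<in> sections_in B \<and> f i \<in> smooth_functions M) \<and>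
     (\<forall>i<r. \<forall>j<r. \<forall>x. anchor_deriv (e i) (f j) x = (if i = j then g x else 0))"

text \<open>
  \<open>g\<close> times the part of \<open>s\<close> that the system does not account for: if the system is dual, its anchor annihilates all \<open>f j\<close>.
\<close>

definition residual ::
  "nat \<Rightarrow> ('m \<Rightarrow> complex) \<Rightarrow> (nat \<Rightarrow> 'm \<Rightarrow> 'e) \<Rightarrow> (nat \<Rightarrow> 'm \<Rightarrow> complex) \<Rightarrow> ('m \<Rightarrow> 'e) \<Rightarrow> 'm \<Rightarrow> 'e" where
  "residual r g e f s = sec_add A (sec_scale A g s) (lincomb r (\<lambda>j x. - anchor_deriv s (f j) x) e)"

lemma residual:
  assumes B: "is_subbundle M A B" and dual: "dual_system B r g e f" and s: "s \<in> sections_in B"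
  shows "residual r g e f s \<in> sections_in B"
    and "anchor_deriv (residual r g e f s) h x =
      g x * anchor_deriv s h x - (\<Sum>j<r. anchor_deriv s (f j) x * anchor_deriv (e j) h x)"
proof -
  have g: "g \<in> smooth_functions M" and ef: "\<And>i. i < r \<Longrightarrow> e i \<in> sections_in B" "\<And>i. i < r \<Longrightarrow> f i \<in> smooth_functions M"
    using dual by (auto simp: dual_system_def)
  let ?c = "\<lambda>j x. - anchor_deriv s (f j) x"
  have c: "?c j \<in> smooth_functions M" if "j < r" for j
    using s ef(2)[OF that] by (intro smooth_functions_uminus anchor_deriv_smooth) simp_all
  note l = lincomb_closed[OF B c ef(1)] and gs = sections_in_scale[OF B g s]
  show "residual r g e f s \<in> sections_in B"
    unfolding residual_def by (rule sections_in_add[OF B gs l])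
  have "anchor_deriv (residual r g e f s) h x = g x * anchor_deriv s h x + anchor_deriv (lincomb r ?c e) h x"
    unfolding residual_def using l gs s by (simp add: anchor_deriv_add anchor_deriv_scale)
  also have "anchor_deriv (lincomb r ?c e) h x = (\<Sum>j<r. ?c j x * anchor_deriv (e j) h x)"
    by (rule anchor_deriv_lincomb[OF B c ef(1)])
  finally show "anchor_deriv (residual r g e f s) h x =
      g x * anchor_deriv s h x - (\<Sum>j<r. anchor_deriv s (f j) x * anchor_deriv (e j) h x)"
    by (simp add: sum_negf)
qed

text \<open>
  One step of division-free Gauss-Jordan elimination, with pivot \<open>v\<close> the derivative of a further
  function \<open>h\<close> along the residual \<open>t\<close> of \<open>s\<close>. As \<open>t\<close> annihilates the old functions, subtracting a
  multiple of \<open>t\<close> from \<open>v e\<^sub>i\<close> clears the new column and leaves the old ones alone; \<open>g t\<close> is the new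
  row.
\<close>

lemma dual_system_extend:
  assumes B: "is_subbundle M A B" and dual: "dual_system B r g e f"
    and s: "s \<in> sections_in B" and h: "h \<in> smooth_functions M"
  defines "t \<equiv> residual r g e f s"
  defines "v \<equiv> anchor_deriv t h"
  shows "dual_system B (Suc r) (\<lambda>x. g x * v x)
    (\<lambda>i. if i < r then sec_add A (sec_scale A v (e i)) (sec_scale A (\<lambda>x. - anchor_deriv (e i) h x) t)
         else sec_scale A g t) (f(r := h))"
proof -
  have g: "g \<in> smooth_functions M" and ef: "\<And>i. i < r \<Longrightarrow> e i \<in> sections_in B" "\<And>i. i < r \<Longrightarrow> f i \<in> smooth_functions M"
    and d: "\<And>i j x. i < r \<Longrightarrow> j < r \<Longrightarrow> anchor_deriv (e i) (f j) x = (if i = j then g x else 0)"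
    using dual by (auto simp: dual_system_def)
  have t: "t \<in> sections_in B" unfolding t_def by (rule residual(1)[OF B dual s])
  then have t': "t \<in> sections M A" by simp
  have v: "v \<in> smooth_functions M" unfolding v_def by (rule anchor_deriv_smooth[OF t' h])
  have tf: "anchor_deriv t (f j) x = 0" if "j < r" for j x
  proof -
    have "(\<Sum>i<r. anchor_deriv s (f i) x * anchor_deriv (e i) (f j) x)
        = (\<Sum>i<r. if i = j then anchor_deriv s (f i) x * g x else 0)"
      using that by (intro sum.cong) (auto simp: d)
    then show ?thesis
      unfolding t_def residual(2)[OF B dual s] using that by simp
  qed
  let ?e = "\<lambda>i. sec_add A (sec_scale A v (e i)) (sec_scale A (\<lambda>x. - anchor_deriv (e i) h x) t)"
  have c: "(\<lambda>x. - anchor_deriv (e i) h x) \<in> smooth_functions M" if "i < r" for i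
    using ef(1)[OF that] h by (intro smooth_functions_uminus anchor_deriv_smooth) simp_all
  have e_in: "?e i \<in> sections_in B" if "i < r" for i
    by (intro sections_in_add[OF B] sections_in_scale[OF B] v ef(1) c t that)
  have e_val: "anchor_deriv (?e i) k x = v x * anchor_deriv (e i) k x - anchor_deriv (e i) h x * anchor_deriv t k x"
    if "i < r" for i k x
  proof -
    have "e i \<in> sections M A" using ef(1)[OF that] by simp
    then show ?thesis
      by (simp add: anchor_deriv_add anchor_deriv_scale sections_scale t' v c[OF that])
  qed
  have t_in: "sec_scale A g t \<in> sections_in B" by (rule sections_in_scale[OF B g t])
  have t_val: "anchor_deriv (sec_scale A g t) k x = g x * anchor_deriv t k x" for k x
    by (rule anchor_deriv_scale[OF t'])
  have v': "anchor_deriv t h x = v x" for x by (simp add: v_def)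
  show ?thesis
    unfolding dual_system_def
  proof (intro conjI allI impI)
    show "(\<lambda>x. g x * v x) \<in> smooth_functions M" by (rule smooth_functions_mult[OF g v])
    fix i assume i: "i < Suc r"
    show "(if i < r then ?e i else sec_scale A g t) \<in> sections_in B"
      using e_in t_in by (cases "i < r") (simp_all only: if_True if_False)
    show "(f(r := h)) i \<in> smooth_functions M" using ef(2) h i by (cases "i < r") (auto simp: less_Suc_eq)
    fix j x assume j: "j < Suc r"
    consider "i < r" "j < r" | "i < r" "j = r" | "i = r" "j < r" | "i = r" "j = r"
      using i j by linarith
    then show "anchor_deriv (if i < r then ?e i else sec_scale A g t) ((f(r := h)) j) x
        = (if i = j then g x * v x else 0)"
      by cases (simp_all add: e_val t_val tf d v')
  qed
qed

text \<open>
  At a point with \<open>g \<noteq> 0\<close> the values of the sections are linearly independent in the fibre.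
\<close>

lemma dual_system_le_fibre_dim:
  assumes "dual_system B r g e f" "fibrewise_iso A U d \<phi>" "x \<in> U" "g x \<noteq> 0"
  shows "r \<le> d"
proof (rule dual_system_le_rank[where L = "\<lambda>j a. ctangent_apply (\<rho> a) (f j)" and e = "\<lambda>i. e i x" and g = "g x"])
  show "fibrewise_iso A U d \<phi>" "x \<in> U" "g x \<noteq> 0" by fact+
  show "e i x \<in> fibre A x" if "i < r" for i
    using assms(1) that sections_fibre by (auto simp: dual_system_def)
  show "ctangent_apply (\<rho> (e i x)) (f j) = (if i = j then g x else 0)" if "i < r" "j < r" for i j
    using assms(1) that by (auto simp: dual_system_def anchor_deriv_def vf_apply_def)
qed (simp_all add: anchor_add anchor_scale ctangent_apply_add ctangent_apply_scale)

text \<open>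
  The empty system with \<open>g = u\<close> is a dual system, and the sizes are bounded by \<open>d\<close>. For a system of
  maximal size the pivot of every further elimination step must vanish identically after
  multiplication by \<open>g\<close>.
\<close>

lemma maximal_dual_system:
  fixes u :: "'m \<Rightarrow> complex"
  assumes B: "is_subbundle M A B"
    and u: "u \<in> smooth_functions M" "u x0 \<noteq> 0" "\<And>x. u x \<noteq> 0 \<Longrightarrow> x \<in> U" and \<phi>: "fibrewise_iso A U d \<phi>"
  obtains r g e f x1 where "dual_system B r g e f" "g x1 \<noteq> 0" "\<And>x. g x \<noteq> 0 \<Longrightarrow> u x \<noteq> 0"
    "\<And>s h x. s \<in> sections_in B \<Longrightarrow> h \<in> smooth_functions M \<Longrightarrow>
      g x * anchor_deriv (residual r g e f s) h x = 0"
proof -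
  define P where "P r = (\<exists>g e f. dual_system B r g e f \<and> (\<exists>x. g x \<noteq> 0) \<and> (\<forall>x. g x \<noteq> 0 \<longrightarrow> u x \<noteq> 0))" for r
  have "dual_system B 0 u e f" for e f using u(1) by (simp add: dual_system_def)
  then have "P 0" unfolding P_def using u(2) by blast
  moreover have "\<forall>r. P r \<longrightarrow> r \<le> d"
    unfolding P_def using dual_system_le_fibre_dim[OF _ \<phi>] u(3) by blast
  ultimately obtain r where r: "P r" and max: "\<And>r'. P r' \<Longrightarrow> r' \<le> r"
    using ex_has_greatest_nat[of P 0 "\<lambda>r. r" "Suc d"] by (auto simp: less_Suc_eq_le)
  obtain g e f x1 where dual: "dual_system B r g e f" and g: "g x1 \<noteq> 0" "\<And>x. g x \<noteq> 0 \<Longrightarrow> u x \<noteq> 0"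
    using r unfolding P_def by blast
  have "g x * anchor_deriv (residual r g e f s) h x = 0"
    if s: "s \<in> sections_in B" and h: "h \<in> smooth_functions M" for s h x
  proof (rule ccontr)
    assume "g x * anchor_deriv (residual r g e f s) h x \<noteq> 0"
    moreover have "\<forall>y. g y * anchor_deriv (residual r g e f s) h y \<noteq> 0 \<longrightarrow> u y \<noteq> 0"
      using g(2) by simp
    ultimately have "P (Suc r)"
      unfolding P_def using dual_system_extend[OF B dual s h]
      by (intro exI conjI) assumption+
    then show False using max[of "Suc r"] by simp
  qed
  with dual g show thesis by (rule that)
qed

text \<open>
  Substitute for \<open>G\<close> the function \<open>g\<^sup>2\<close> of a maximal dual system. Where \<open>Z x = \<rho> a\<close>, the vanishing of the
  residual of a section through \<open>a\<close> says that \<open>g\<^sup>2 Z = g \<Sum>\<^sub>j (Z f\<^sub>j) \<rho> e\<^sub>j\<close> at \<open>x\<close>. The right-hand side has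
  smooth coefficients which do not depend on the choice of \<open>a\<close>, so it is the anchor of a section.
\<close>

lemma generic_lift:
  fixes u :: "'m \<Rightarrow> complex"
  assumes B: "is_subbundle M A B" and u: "u \<in> smooth_functions M" "u x0 \<noteq> 0"
    and U: "\<And>x. u x \<noteq> 0 \<Longrightarrow> x \<in> U" and \<phi>: "fibrewise_iso A U d \<phi>"
  obtains G x1 where "G \<in> smooth_functions M" "G x1 \<noteq> 0" "u x1 \<noteq> 0"
    "\<forall>Z\<in>smooth_cvector_fields M. (\<forall>x. \<exists>a\<in>fibre A x. a \<in> B \<and> \<rho> a = Z x) \<longrightarrow>
      (\<exists>\<alpha>\<in>sections_in B. \<forall>x. \<rho> (\<alpha> x) = ctangent_scale (G x) (Z x))"
proof -
  obtain r g e f x1 where dual: "dual_system B r g e f" and g: "g x1 \<noteq> 0" "\<And>x. g x \<noteq> 0 \<Longrightarrow> u x \<noteq> 0"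
    and max: "\<And>s h x. s \<in> sections_in B \<Longrightarrow> h \<in> smooth_functions M \<Longrightarrow>
      g x * anchor_deriv (residual r g e f s) h x = 0"
    by (rule maximal_dual_system[OF B u _ \<phi>], erule U) (rule that)
  have gs: "g \<in> smooth_functions M" and ef: "\<And>i. i < r \<Longrightarrow> e i \<in> sections_in B" "\<And>i. i < r \<Longrightarrow> f i \<in> smooth_functions M"
    using dual by (auto simp: dual_system_def)
  show thesis
  proof (rule that[of "\<lambda>x. g x * g x" x1])
    show "(\<lambda>x. g x * g x) \<in> smooth_functions M" by (rule smooth_functions_mult[OF gs gs])
    show "g x1 * g x1 \<noteq> 0" "u x1 \<noteq> 0" using g by auto
    have "\<exists>\<alpha>\<in>sections_in B. \<forall>x. \<rho> (\<alpha> x) = ctangent_scale (g x * g x) (Z x)"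
      if Z: "Z \<in> smooth_cvector_fields M" and im: "\<forall>x. \<exists>a\<in>fibre A x. a \<in> B \<and> \<rho> a = Z x" for Z
    proof -
    define c where "c = (\<lambda>j x. g x * vf_apply Z (f j) x)"
    have c: "c j \<in> smooth_functions M" if "j < r" for j
      unfolding c_def by (rule smooth_functions_mult[OF gs vf_apply_smooth[OF Z ef(2)[OF that]]])
    let ?\<alpha> = "lincomb r c e"
    have \<alpha>: "?\<alpha> \<in> sections_in B" by (rule lincomb_closed[OF B c ef(1)])
    have "\<rho> (?\<alpha> x) = ctangent_scale (g x * g x) (Z x)" for x
    proof -
      obtain a where a: "a \<in> fibre A x" "a \<in> B" "\<rho> a = Z x" using im by blast
      obtain s where s: "s \<in> sections M A" "\<And>y. s y \<in> B" "s x = a"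
        using subbundle_section_through[OF B a(1,2)] by blast
      have sx: "anchor_deriv s h x = vf_apply Z h x" for h
        by (simp add: anchor_deriv_def vf_apply_def s(3) a(3))
      show ?thesis
      proof (rule ctangent_eqI)
        show "\<rho> (?\<alpha> x) \<in> ctangent_space M x" using \<alpha> sections_fibre anchor_fibre by simp
        show "ctangent_scale (g x * g x) (Z x) \<in> ctangent_space M x"
          using anchor_fibre[OF fib_scale_closed[OF a(1)], of "g x * g x"] anchor_scale[OF a(1)] a(3) by simp
        fix h :: "'m \<Rightarrow> real" assume h: "h \<in> smooth_functions M"
        let ?h = "\<lambda>y. complex_of_real (h y)"
        have "ctangent_apply (\<rho> (?\<alpha> x)) ?h = anchor_deriv ?\<alpha> ?h x"
          by (simp add: anchor_deriv_def vf_apply_def)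
        also have "\<dots> = (\<Sum>j<r. c j x * anchor_deriv (e j) ?h x)"
          by (rule anchor_deriv_lincomb[OF B c ef(1)])
        also have "\<dots> = g x * (\<Sum>j<r. vf_apply Z (f j) x * anchor_deriv (e j) ?h x)"
          by (simp add: c_def sum_distrib_left mult.assoc)
        also have "\<dots> = g x * (g x * vf_apply Z ?h x)"
          using max[of s ?h x] residual(2)[OF B dual, of s ?h x] s smooth_functions_of_real[OF h]
          by (auto simp: sx)
        finally show "ctangent_apply (\<rho> (?\<alpha> x)) ?h = ctangent_apply (ctangent_scale (g x * g x) (Z x)) ?h"
          by (simp add: ctangent_apply_scale vf_apply_def mult.assoc)
      qed
    qed
    with \<alpha> show ?thesis by blast
    qed
    then show "\<forall>Z\<in>smooth_cvector_fields M. (\<forall>x. \<exists>a\<in>fibre A x. a \<in> B \<and> \<rho> a = Z x) \<longrightarrow>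
      (\<exists>\<alpha>\<in>sections_in B. \<forall>x. \<rho> (\<alpha> x) = ctangent_scale (g x * g x) (Z x))"
      by (intro ballI impI)
  qed
qed

section \<open>Closure under the bracket\<close>

text \<open>
  Being outside \<open>B\<close> is an open condition, here witnessed by one function: a bump function times a
  coordinate transversal to \<open>B\<close> in an adapted trivialization.
\<close>

lemma section_outside_subbundle:
  assumes B: "is_subbundle M A B" and \<gamma>: "\<gamma> \<in> sections M A" "\<gamma> x0 \<notin> B"
  obtains u :: "'m \<Rightarrow> complex" and U d \<phi> where "u \<in> smooth_functions M" "u x0 \<noteq> 0" "\<And>x. u x \<noteq> 0 \<Longrightarrow> x \<in> U \<and> \<gamma> x \<notin> B"
    "fibrewise_iso A U d \<phi>"
proof -
  obtain U k \<phi> where t: "(U, k, \<phi>) \<in> adapted_trivs M A B" and x0: "x0 \<in> U"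
    using B by (rule adapted_cover)
  obtain d where "k \<le> d" and l: "(U, d, \<phi>) \<in> local_trivializations M A"
    and a: "\<And>x e. x \<in> U \<Longrightarrow> e \<in> fibre A x \<Longrightarrow> e \<in> B \<longleftrightarrow> \<phi> e \<in> cspace k"
    using t by (rule adapted_trivD) (rule that)
  note T = local_trivializationD(1,2)[OF l]
  have "\<phi> (\<gamma> x0) \<notin> cspace k" using a[OF x0 sections_fibre[OF \<gamma>(1)]] \<gamma>(2) by simp
  then obtain i where i: "k \<le> i" "\<phi> (\<gamma> x0) i \<noteq> 0" by (auto simp: cspace_def)
  obtain h :: "'m \<Rightarrow> real" and K where h: "smooth_on M UNIV h" "h x0 \<noteq> 0"
    and K: "closed K" "K \<subseteq> U" "\<And>y. y \<notin> K \<Longrightarrow> h y = 0"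
    using bump_function[OF T(1) x0] by metis
  define u where "u = (\<lambda>x. if x \<in> U then complex_of_real (h x) * \<phi> (\<gamma> x) i else 0)"
  show thesis
  proof (rule that[of u U d \<phi>])
    have "smooth_on M U (\<lambda>x. complex_of_real (h x) * \<phi> (\<gamma> x) i)"
      using smooth_on_bounded_linear[OF T(1) bounded_linear_of_real smooth_on_subset[OF h(1)]]
      by (intro smooth_on_mult T(1) sections_coordinate_smooth[OF \<gamma>(1) l]) simp_all
    then have "smooth_on M UNIV u"
      unfolding u_def by (rule smooth_on_extend_zero[OF T(1) K(1,2)]) (simp add: K(3))
    then show "u \<in> smooth_functions M" by (simp add: smooth_functions_def)
    show "u x0 \<noteq> 0" using x0 h(2) i(2) by (simp add: u_def)
    show "x \<in> U \<and> \<gamma> x \<notin> B" if "u x \<noteq> 0" for x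
    proof
      show x: "x \<in> U" using that by (simp add: u_def split: if_splits)
      have "\<phi> (\<gamma> x) i \<noteq> 0" using that x by (simp add: u_def)
      then have "\<phi> (\<gamma> x) \<notin> cspace k" using i(1) by (auto simp: cspace_def)
      then show "\<gamma> x \<notin> B" using a[OF x sections_fibre[OF \<gamma>(1)]] by simp
    qed
  qed (rule T(2))
qed

lemma min_part_cnj:
  assumes "e \<in> fibre A x" "e \<in> min_part A \<rho>"
  shows "\<exists>a\<in>fibre A x. a \<in> min_part A \<rho> \<and> \<rho> a = ctangent_cnj (\<rho> e)"
proof -
  obtain a where a: "a \<in> fibre A x" "\<rho> a = ctangent_cnj (\<rho> e)"
    using assms min_part_iff by blast
  have "\<rho> e = ctangent_cnj (\<rho> a)" by (simp add: a(2) ctangent_cnj_def)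
  then have "a \<in> min_part A \<rho>" using min_part_iff[OF a(1)] assms(1) by blast
  with a show ?thesis by blast
qed

text \<open>
  The set where the bracket leaves \<open>B\<close> would contain a point at which the conjugates of \<open>\<rho> \<alpha>\<close> and
  \<open>\<rho> \<beta>\<close>, multiplied by a function \<open>G\<close> that is nonzero there, lift to sections \<open>\<alpha>'\<close> and \<open>\<beta>'\<close> of \<open>A\<close>. There the conjugate of
  \<open>\<rho> [\<alpha>, \<beta>]\<close> is the anchor of an explicit combination of \<open>[\<alpha>', \<beta>']\<close>, \<open>\<alpha>'\<close> and \<open>\<beta>'\<close>, which places
  \<open>[\<alpha>, \<beta>]\<close> in \<open>B\<close> after all.
\<close>

lemma br_min_part:
  assumes B: "is_subbundle M A (min_part A \<rho>)"
    and \<alpha>: "\<alpha> \<in> sections_in (min_part A \<rho>)" and \<beta>: "\<beta> \<in> sections_in (min_part A \<rho>)"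
  shows "br \<alpha> \<beta> \<in> sections_in (min_part A \<rho>)"
proof -
  have s: "\<alpha> \<in> sections M A" "\<beta> \<in> sections M A" using \<alpha> \<beta> by auto
  note br = br_closed[OF s]
  have "br \<alpha> \<beta> x0 \<in> min_part A \<rho>" for x0
  proof (rule ccontr)
    assume x0: "br \<alpha> \<beta> x0 \<notin> min_part A \<rho>"
    obtain u :: "'m \<Rightarrow> complex" and U d \<phi> where u: "u \<in> smooth_functions M" "u x0 \<noteq> 0"
      and out: "\<And>x. u x \<noteq> 0 \<Longrightarrow> x \<in> U \<and> br \<alpha> \<beta> x \<notin> min_part A \<rho>" and \<phi>: "fibrewise_iso A U d \<phi>"
      by (rule section_outside_subbundle[OF B br x0]) (rule that)
    have uU: "\<And>x. u x \<noteq> 0 \<Longrightarrow> x \<in> U" using out by blast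
    obtain G x1 where G: "G \<in> smooth_functions M" "G x1 \<noteq> 0" "u x1 \<noteq> 0"
      and lift: "\<forall>Z\<in>smooth_cvector_fields M.
        (\<forall>x. \<exists>a\<in>fibre A x. a \<in> min_part A \<rho> \<and> \<rho> a = Z x) \<longrightarrow>
        (\<exists>\<alpha>\<in>sections_in (min_part A \<rho>). \<forall>x. \<rho> (\<alpha> x) = ctangent_scale (G x) (Z x))"
      by (rule generic_lift[OF B u _ \<phi>], erule uU) (rule that)
    have cnj_lift: "\<exists>\<alpha>'\<in>sections_in (min_part A \<rho>).
        \<forall>x. \<rho> (\<alpha>' x) = ctangent_scale (G x) (ctangent_cnj (\<rho> (\<alpha> x)))"
      if \<alpha>: "\<alpha> \<in> sections_in (min_part A \<rho>)" for \<alpha>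
    proof (rule lift[rule_format])
      show "(\<lambda>x. ctangent_cnj (\<rho> (\<alpha> x))) \<in> smooth_cvector_fields M"
        using \<alpha> by (simp add: vf_cnj_closed[OF anchor_smooth])
      show "\<exists>a\<in>fibre A x. a \<in> min_part A \<rho> \<and> \<rho> a = ctangent_cnj (\<rho> (\<alpha> x))" for x
        using \<alpha> by (intro min_part_cnj) (simp_all add: sections_fibre)
    qed
    obtain \<alpha>' where \<alpha>': "\<alpha>' \<in> sections M A" "\<And>x. \<rho> (\<alpha>' x) = ctangent_scale (G x) (ctangent_cnj (\<rho> (\<alpha> x)))"
      using cnj_lift[OF \<alpha>] by blast
    obtain \<beta>' where \<beta>': "\<beta>' \<in> sections M A" "\<And>x. \<rho> (\<beta>' x) = ctangent_scale (G x) (ctangent_cnj (\<rho> (\<beta> x)))"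
      using cnj_lift[OF \<beta>] by blast
    note s' = \<alpha>'(1) \<beta>'(1)
    note fib = sections_fibre[OF br_closed[OF s'], of x1] sections_fibre[OF s'(1), of x1] sections_fibre[OF s'(2), of x1]
    define p where "p = vf_apply (\<lambda>x. ctangent_cnj (\<rho> (\<alpha> x))) G x1"
    define q where "q = vf_apply (\<lambda>x. ctangent_cnj (\<rho> (\<beta> x))) G x1"
    \<comment> \<open>The vector \<open>e\<close> is \<open>[\<alpha>', \<beta>'] - p \<beta>' + q \<alpha>'\<close> divided by \<open>G\<^sup>2\<close>, as dictated by the Leibniz rule.\<close>
    define w where "w = fib_add A (fib_scale A (- p) (\<beta>' x1)) (fib_scale A q (\<alpha>' x1))"
    define e where "e = fib_scale A (1 / (G x1)\<^sup>2) (fib_add A (br \<alpha>' \<beta>' x1) w)"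
    have w: "w \<in> fibre A x1" unfolding w_def using fib by (intro fib_add_closed fib_scale_closed)
    then have e: "e \<in> fibre A x1" unfolding e_def using fib by (intro fib_add_closed fib_scale_closed)
    have \<rho>w: "\<rho> w = ctangent_add (ctangent_scale (- p) (\<rho> (\<beta>' x1))) (ctangent_scale q (\<rho> (\<alpha>' x1)))"
      unfolding w_def
      by (simp add: anchor_add[OF fib_scale_closed[OF fib(3)] fib_scale_closed[OF fib(2)]]
          anchor_scale[OF fib(2)] anchor_scale[OF fib(3)])
    have \<rho>e: "\<rho> e = ctangent_scale (1 / (G x1)\<^sup>2) (ctangent_add (\<rho> (br \<alpha>' \<beta>' x1)) (\<rho> w))"
      unfolding e_def by (simp add: anchor_scale[OF fib_add_closed[OF fib(1) w]] anchor_add[OF fib(1) w])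
    have "\<rho> e = ctangent_cnj (\<rho> (br \<alpha> \<beta> x1))"
    proof (rule ctangent_eqI)
      show "\<rho> e \<in> ctangent_space M x1" by (rule anchor_fibre[OF e])
      show "ctangent_cnj (\<rho> (br \<alpha> \<beta> x1)) \<in> ctangent_space M x1"
        by (rule ctangent_cnj_closed[OF anchor_fibre[OF sections_fibre[OF br]]])
      fix f :: "'m \<Rightarrow> real" assume f: "f \<in> smooth_functions M"
      let ?F = "\<lambda>y. complex_of_real (f y)"
      have "(G x1)\<^sup>2 * ctangent_apply (ctangent_cnj (\<rho> (br \<alpha> \<beta> x1))) ?F =
          ctangent_apply (\<rho> (br \<alpha>' \<beta>' x1)) ?F
          - p * ctangent_apply (\<rho> (\<beta>' x1)) ?F + q * ctangent_apply (\<rho> (\<alpha>' x1)) ?F"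
        using vf_bracket_scaled_cnj[OF s[THEN anchor_smooth] s'[THEN anchor_smooth] G(1) f \<alpha>'(2) \<beta>'(2), of x1]
          fun_cong[OF anchor_br[OF s], of x1] fun_cong[OF anchor_br[OF s'], of x1]
        by (simp add: p_def q_def vf_apply_def)
      also have "\<dots> = (G x1)\<^sup>2 * ctangent_apply (\<rho> e) ?F"
        using G(2) by (simp add: \<rho>e \<rho>w ctangent_apply_scale ctangent_apply_add)
      finally show "ctangent_apply (\<rho> e) ?F = ctangent_apply (ctangent_cnj (\<rho> (br \<alpha> \<beta> x1))) ?F"
        using G(2) by simp
    qed
    then have "br \<alpha> \<beta> x1 \<in> min_part A \<rho>"
      using min_part_iff[OF sections_fibre[OF br]] e by blast
    then show False using out[OF G(3)] by blast
  qed
  then show ?thesis using br by blast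
qed

text \<open>
  The axioms for \<open>B\<close> are instances of those for \<open>A\<close>, because the sections of \<open>B\<close> are sections of \<open>A\<close>.
  The restricted operations are \<open>undefined\<close> elsewhere, so each instance relies on the closure of
  the sections of \<open>B\<close> under sums, smooth multiples and brackets.
\<close>

lemma subbundle_restriction_subalgebroid:
  assumes B: "is_subbundle M A B"
    and br_B: "\<And>\<alpha> \<beta>. \<alpha> \<in> sections_in B \<Longrightarrow> \<beta> \<in> sections_in B \<Longrightarrow> br \<alpha> \<beta> \<in> sections_in B"
  defines "\<Gamma> \<equiv> sections M (subbundle M A B)"
  shows "complex_lie_subalgebroid M A br \<rho> B (\<lambda>\<alpha>\<in>\<Gamma>. \<lambda>\<beta>\<in>\<Gamma>. br \<alpha> \<beta>) (restrict \<rho> B)"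
proof -
  let ?S = "subbundle M A B" and ?br = "\<lambda>\<alpha>\<in>\<Gamma>. \<lambda>\<beta>\<in>\<Gamma>. br \<alpha> \<beta>" and ?\<rho> = "restrict \<rho> B"
  have \<Gamma>: "\<Gamma> = sections_in B" unfolding \<Gamma>_def by (rule sections_subbundle[OF B])
  have sec: "\<alpha> \<in> sections M A" "\<alpha> x \<in> B" if "\<alpha> \<in> \<Gamma>" for \<alpha> x using that by (auto simp: \<Gamma>)
  have ops: "fib_zero ?S = fib_zero A" "fib_add ?S = fib_add A" "fib_scale ?S = fib_scale A"
    "sec_add ?S = sec_add A" "sec_scale ?S = sec_scale A"
    by (simp_all add: subbundle_def sec_add_def sec_scale_def fun_eq_iff)
  have br: "?br \<alpha> \<beta> = br \<alpha> \<beta>" if "\<alpha> \<in> \<Gamma>" "\<beta> \<in> \<Gamma>" for \<alpha> \<beta> using that by simp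
  have br_cl: "br \<alpha> \<beta> \<in> \<Gamma>" if "\<alpha> \<in> \<Gamma>" "\<beta> \<in> \<Gamma>" for \<alpha> \<beta> using that br_B unfolding \<Gamma> by blast
  have add_cl: "sec_add A \<alpha> \<beta> \<in> \<Gamma>" if "\<alpha> \<in> \<Gamma>" "\<beta> \<in> \<Gamma>" for \<alpha> \<beta>
    using that unfolding \<Gamma> by (rule sections_in_add[OF B])
  have scale_cl: "sec_scale A f \<alpha> \<in> \<Gamma>" if "f \<in> smooth_functions M" "\<alpha> \<in> \<Gamma>" for f \<alpha>
    using that unfolding \<Gamma> by (rule sections_in_scale[OF B])
  have const: "(\<lambda>x. c) \<in> smooth_functions M" for c :: complex by (rule smooth_functions_const)
  have \<rho>_sec: "(\<lambda>x. ?\<rho> (\<alpha> x)) = (\<lambda>x. \<rho> (\<alpha> x))" if "\<alpha> \<in> \<Gamma>" for \<alpha>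
    using sec(2)[OF that] by simp
  have fib: "a \<in> fibre ?S x \<longleftrightarrow> a \<in> fibre A x \<and> a \<in> B" for a x by (simp add: fibre_subbundle[OF B])
  interpret S: complex_vector_bundle M ?S by (rule subbundle_complex_vector_bundle[OF B])
  have "complex_lie_algebroid M ?S ?br ?\<rho>"
  proof (intro complex_lie_algebroid.intro complex_lie_algebroid_axioms.intro S.complex_vector_bundle_axioms;
      (unfold ops \<Gamma>_def[symmetric])?)
    fix \<alpha> \<beta> \<gamma> :: "'m \<Rightarrow> 'e" and c :: complex and f :: "'m \<Rightarrow> complex"
    assume \<alpha>: "\<alpha> \<in> \<Gamma>"
    show "?br \<alpha> \<alpha> = fib_zero A" by (simp only: br[OF \<alpha> \<alpha>] br_alternating[OF sec(1)[OF \<alpha>]])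
    show "(\<lambda>x. ?\<rho> (\<alpha> x)) \<in> smooth_cvector_fields M"
      unfolding \<rho>_sec[OF \<alpha>] by (rule anchor_smooth[OF sec(1)[OF \<alpha>]])
    assume \<beta>: "\<beta> \<in> \<Gamma>"
    note s = sec(1)[OF \<alpha>] sec(1)[OF \<beta>]
    show "?br \<alpha> \<beta> \<in> \<Gamma>" by (simp only: br[OF \<alpha> \<beta>] br_cl[OF \<alpha> \<beta>])
    show "?br (sec_scale A (\<lambda>x. c) \<alpha>) \<beta> = sec_scale A (\<lambda>x. c) (?br \<alpha> \<beta>)"
      by (simp only: br[OF scale_cl[OF const \<alpha>] \<beta>] br[OF \<alpha> \<beta>] br_scale_left[OF s])
    show "?br \<alpha> (sec_scale A (\<lambda>x. c) \<beta>) = sec_scale A (\<lambda>x. c) (?br \<alpha> \<beta>)"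
      by (simp only: br[OF \<alpha> scale_cl[OF const \<beta>]] br[OF \<alpha> \<beta>] br_scale_right[OF s])
    show "(\<lambda>x. ?\<rho> (?br \<alpha> \<beta> x)) = vf_bracket M (\<lambda>x. ?\<rho> (\<alpha> x)) (\<lambda>x. ?\<rho> (\<beta> x))"
      by (simp only: br[OF \<alpha> \<beta>] \<rho>_sec[OF br_cl[OF \<alpha> \<beta>]] \<rho>_sec[OF \<alpha>] \<rho>_sec[OF \<beta>] anchor_br[OF s])
    show "?br \<alpha> (sec_scale A f \<beta>) =
        sec_add A (sec_scale A f (?br \<alpha> \<beta>)) (sec_scale A (vf_apply (\<lambda>x. ?\<rho> (\<alpha> x)) f) \<beta>)"
      if f: "f \<in> smooth_functions M"
      by (simp only: br[OF \<alpha> scale_cl[OF f \<beta>]] br[OF \<alpha> \<beta>] \<rho>_sec[OF \<alpha>] br_leibniz[OF s f])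
    assume \<gamma>: "\<gamma> \<in> \<Gamma>"
    note s' = s sec(1)[OF \<gamma>]
    show "?br (sec_add A \<alpha> \<beta>) \<gamma> = sec_add A (?br \<alpha> \<gamma>) (?br \<beta> \<gamma>)"
      by (simp only: br[OF add_cl[OF \<alpha> \<beta>] \<gamma>] br[OF \<alpha> \<gamma>] br[OF \<beta> \<gamma>] br_add_left[OF s'])
    show "?br \<alpha> (sec_add A \<beta> \<gamma>) = sec_add A (?br \<alpha> \<beta>) (?br \<alpha> \<gamma>)"
      by (simp only: br[OF \<alpha> add_cl[OF \<beta> \<gamma>]] br[OF \<alpha> \<beta>] br[OF \<alpha> \<gamma>] br_add_right[OF s'])
    show "sec_add A (?br \<alpha> (?br \<beta> \<gamma>)) (sec_add A (?br \<beta> (?br \<gamma> \<alpha>)) (?br \<gamma> (?br \<alpha> \<beta>))) = fib_zero A"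
      by (simp only: br[OF \<beta> \<gamma>] br[OF \<gamma> \<alpha>] br[OF \<alpha> \<beta>] br[OF \<alpha> br_cl[OF \<beta> \<gamma>]]
          br[OF \<beta> br_cl[OF \<gamma> \<alpha>]] br[OF \<gamma> br_cl[OF \<alpha> \<beta>]] br_jacobi[OF s'])
  next
    fix a b x and c :: complex
    assume "a \<in> fibre ?S x"
    then have a: "a \<in> fibre A x" "a \<in> B" by (simp_all add: fib)
    show "?\<rho> a \<in> ctangent_space M x" using anchor_fibre[OF a(1)] a(2) by simp
    show "?\<rho> (fib_scale A c a) = ctangent_scale c (?\<rho> a)"
      using anchor_scale[OF a(1)] subbundle_linear(3)[OF B a] a(2) by simp
    assume "b \<in> fibre ?S x"
    then have b: "b \<in> fibre A x" "b \<in> B" by (simp_all add: fib)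
    show "?\<rho> (fib_add A a b) = ctangent_add (?\<rho> a) (?\<rho> b)"
      using anchor_add[OF a(1) b(1)] subbundle_linear(2)[OF B a(1) b(1) a(2) b(2)] a(2) b(2) by simp
  qed
  then show ?thesis
    unfolding complex_lie_subalgebroid_def \<Gamma>_def[symmetric]
    using complex_lie_algebroid_axioms B br by simp
qed

end

theorem proposition3p11:
  fixes M :: "'m::{t2_space, second_countable_topology} manifold"
    and A :: "('m, 'e) cvbundle"
    and br :: "('m \<Rightarrow> 'e) \<Rightarrow> ('m \<Rightarrow> 'e) \<Rightarrow> 'm \<Rightarrow> 'e"
    and \<rho> :: "'e \<Rightarrow> 'm ctangent"
  defines "A\<^sub>m\<^sub>i\<^sub>n \<equiv> min_part A \<rho>"
  defines "\<Gamma>\<^sub>m\<^sub>i\<^sub>n \<equiv> sections M (subbundle M A A\<^sub>m\<^sub>i\<^sub>n)"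
  defines "br\<^sub>m\<^sub>i\<^sub>n \<equiv> \<lambda>\<alpha>\<in>\<Gamma>\<^sub>m\<^sub>i\<^sub>n. \<lambda>\<beta>\<in>\<Gamma>\<^sub>m\<^sub>i\<^sub>n. br \<alpha> \<beta>"
  defines "\<rho>\<^sub>m\<^sub>i\<^sub>n \<equiv> restrict \<rho> A\<^sub>m\<^sub>i\<^sub>n"
  assumes "complex_lie_algebroid M A br \<rho>"
    and "is_subbundle M A A\<^sub>m\<^sub>i\<^sub>n"
  shows "complex_lie_subalgebroid M A br \<rho> A\<^sub>m\<^sub>i\<^sub>n br\<^sub>m\<^sub>i\<^sub>n \<rho>\<^sub>m\<^sub>i\<^sub>n \<and>
         re_part (subbundle M A A\<^sub>m\<^sub>i\<^sub>n) \<rho>\<^sub>m\<^sub>i\<^sub>n = re_part A \<rho>"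
proof -
  interpret complex_lie_algebroid M A br \<rho> by fact
  have B: "is_subbundle M A (min_part A \<rho>)" using assms by simp
  have "complex_lie_subalgebroid M A br \<rho> A\<^sub>m\<^sub>i\<^sub>n br\<^sub>m\<^sub>i\<^sub>n \<rho>\<^sub>m\<^sub>i\<^sub>n"
    unfolding br\<^sub>m\<^sub>i\<^sub>n_def \<rho>\<^sub>m\<^sub>i\<^sub>n_def \<Gamma>\<^sub>m\<^sub>i\<^sub>n_def A\<^sub>m\<^sub>i\<^sub>n_def
    by (rule subbundle_restriction_subalgebroid[OF B br_min_part[OF B]])
  moreover have "re_part (subbundle M A A\<^sub>m\<^sub>i\<^sub>n) \<rho>\<^sub>m\<^sub>i\<^sub>n = re_part A \<rho>"
    using re_part_subset_min_part B
    by (auto simp: re_part_def subbundle_def A\<^sub>m\<^sub>i\<^sub>n_def \<rho>\<^sub>m\<^sub>i\<^sub>n_def is_subbundle_def)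
  ultimately show ?thesis ..
qed

end
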